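(* Let $X$ be a separable Banach space. Then $X$ has the $\pi$-property but does not have a finite dimensional decomposition if and only if there exists an increasing sequence $\{X_i\}_{i=1}^\infty$ of finite-dimensional subspaces of $X$ satisfying the following three conditions: (a) $\sup_i \lambda(X_i,X)<\infty$; (b) $\overline{\bigcup_{i=1}^\infty X_i}=X$ (norm closure); (c) for every subsequence $\{X_{i_n}\}_{n=1}^\infty$ of $\{X_i\}_{i=1}^\infty$ and every sequence $\{P_n\}_{n=1}^\infty$ of projections, where $P_n:X_{i_{n+1}}\to X_{i_n}$ is a projection of $X_{i_{n+1}}$ onto $X_{i_n}$, one has $$\sup_{k,l\in\mathbf{N},\ k<l}\|P_kP_{k+1}\cdots P_{l-1}P_l\|=\infty .$$
   Context: Projections are bounded linear idempotent operators. A projection of a normed space $Z$ onto a subspace $Y\subset Z$ is a bounded linear map $P:Z\to Y$ with image $Y$ and $Py=y$ for all $y\in Y$ (also regarded as a map $Z\to Z$). A separable Banach space $X$ has the $\pi$-property if there is a sequence $T_n:X\to X$ of finite dimensional projections (projections with finite-dimensional image) such that $\lim_{n\to\infty}\|x-T_nx\|=0$ for all $x\in X$. If there is such a sequence which in addition satisfies $T_nT_m=T_{\min(m,n)}$ for all $n,m\in\mathbf{N}$, then $X$ is said to have a finite dimensional decomposition. For a finite-dimensional subspace $Y$ of a normed space $X$, the relative projection constant is $\lambda(Y,X)=\inf\{\|P\| : P:X\to X \text{ is a projection onto } Y\}$. "Increasing" means $X_i\subset X_{i+1}$ for all $i$. The operator $P_kP_{k+1}\cdots P_l$ is the composition, which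 maps $X_{i_{l+1}}$ to $X_{i_k}$; its norm is the operator norm with respect to the norm of $X$ restricted to these subspaces. *)

theory Defs
  imports "HOL-Analysis.Analysis"
begin

definition finite_dim_subspace :: "'a::real_vector set \<Rightarrow> bool" where
  "finite_dim_subspace S \<longleftrightarrow> (\<exists>B. finite B \<and> S = span B)"

definition projection :: "('a::real_normed_vector \<Rightarrow> 'a) \<Rightarrow> bool" where
  "projection P \<longleftrightarrow> bounded_linear P \<and> P \<circ> P = P"

text \<open>
  Projections of a subspace \<open>Z\<close> onto a smaller subspace \<open>Y\<close>. Only the values of \<open>P\<close> on \<open>Z\<close>
  matter; outside \<open>Z\<close> the total function \<open>P\<close> is arbitrary.
\<close>

definition projection_onto ::
    "'a::real_normed_vector set \<Rightarrow> 'a set \<Rightarrow> ('a \<Rightarrow> 'a) \<Rightarrow> bool" where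
  "projection_onto Z Y P \<longleftrightarrow>
     subspace Z \<and> subspace Y \<and> Y \<subseteq> Z \<and>
     (\<forall>x\<in>Z. \<forall>y\<in>Z. P (x + y) = P x + P y) \<and>
     (\<forall>c. \<forall>x\<in>Z. P (c *\<^sub>R x) = c *\<^sub>R P x) \<and>
     (\<exists>K. \<forall>x\<in>Z. norm (P x) \<le> K * norm x) \<and>
     P ` Z = Y \<and> (\<forall>y\<in>Y. P y = y)"

lemma projection_onto_UNIV_iff:
  "projection_onto UNIV Y P \<longleftrightarrow> projection P \<and> range P = Y"
proof
  assume A: "projection_onto UNIV Y P"
  note defs = A[unfolded projection_onto_def]
  have add: "\<forall>x\<in>UNIV. \<forall>y\<in>UNIV. P (x + y) = P x + P y"
    and scale: "\<forall>c. \<forall>x\<in>UNIV. P (c *\<^sub>R x) = c *\<^sub>R P x"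
    and ran: "range P = Y" and fixes_Y: "\<forall>y\<in>Y. P y = y"
    and bdd: "\<exists>K. \<forall>x\<in>UNIV. norm (P x) \<le> K * norm x"
    using defs by simp_all
  from bdd obtain K where K: "\<forall>x\<in>UNIV. norm (P x) \<le> K * norm x" ..
  have "bounded_linear P"
  proof (rule bounded_linear_intro)
    show "P (x + y) = P x + P y" for x y
      by (rule add[rule_format]) (rule UNIV_I)+
    show "P (r *\<^sub>R x) = r *\<^sub>R P x" for r x
      by (rule scale[rule_format]) (rule UNIV_I)
    show "norm (P x) \<le> norm x * K" for x
      using K[rule_format, OF UNIV_I, of x] by (simp only: mult.commute)
  qed
  moreover have "P \<circ> P = P"
  proof
    fix x
    have "P x \<in> Y"
      unfolding ran[symmetric] by (rule rangeI)
    then show "(P \<circ> P) x = P x"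
      using fixes_Y by simp
  qed
  ultimately show "projection P \<and> range P = Y"
    using ran by (simp add: projection_def)
next
  assume "projection P \<and> range P = Y"
  then have lin: "bounded_linear P" and idem: "P \<circ> P = P" and ran: "range P = Y"
    by (simp_all add: projection_def)
  obtain K where K: "\<forall>x. norm (P x) \<le> norm x * K"
    using bounded_linear.bounded[OF lin] ..
  have "norm (P x) \<le> K * norm x" for x
    using K[rule_format, of x] by (simp only: mult.commute)
  then have bdd: "\<exists>K. \<forall>x\<in>UNIV. norm (P x) \<le> K * norm x"
    by (intro exI ballI)
  have sub: "subspace Y"
    using linear_subspace_image[OF bounded_linear.linear[OF lin] subspace_UNIV]
    by (simp only: ran)
  have fixes_Y: "\<forall>y\<in>Y. P y = y"
  proof
    fix y assume "y \<in> Y"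
    then obtain x where "y = P x"
      unfolding ran[symmetric] by (rule rangeE)
    then show "P y = y"
      using fun_cong[OF idem, of x] by simp
  qed
  show "projection_onto UNIV Y P"
    unfolding projection_onto_def
    by (intro conjI ballI allI subspace_UNIV sub subset_UNIV bdd ran
        linear_add[OF bounded_linear.linear[OF lin]]
        linear_scale[OF bounded_linear.linear[OF lin]] fixes_Y[rule_format])
qed

text \<open>
  Operator norm of \<open>T\<close> restricted to \<open>Z\<close>, following the formula of \<^const>\<open>onorm\<close> but with values
  in the extended reals.
\<close>

definition onorm_on ::
    "'a::real_normed_vector set \<Rightarrow> ('a \<Rightarrow> 'b::real_normed_vector) \<Rightarrow> ereal" where
  "onorm_on Z T = (SUP x\<in>Z. ereal (norm (T x) / norm x))"

text \<open>
  The infimum is taken in the extended reals, so it would be \<open>\<infinity>\<close> if there were no projection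
  onto \<open>Y\<close>.
\<close>

definition relative_projection_constant :: "'a::real_normed_vector set \<Rightarrow> ereal" where
  "relative_projection_constant Y =
     (INF P\<in>{P. projection P \<and> range P = Y}. ereal (onorm P))"

definition pi_property :: "'a::real_normed_vector itself \<Rightarrow> bool" where
  "pi_property _ \<longleftrightarrow>
     (\<exists>T :: nat \<Rightarrow> 'a \<Rightarrow> 'a.
        (\<forall>n. projection (T n) \<and> finite_dim_subspace (range (T n))) \<and>
        (\<forall>x. (\<lambda>n. norm (x - T n x)) \<longlonglongrightarrow> 0))"

definition has_FDD :: "'a::real_normed_vector itself \<Rightarrow> bool" where
  "has_FDD _ \<longleftrightarrow>
     (\<exists>T :: nat \<Rightarrow> 'a \<Rightarrow> 'a.
        (\<forall>n. projection (T n) \<and> finite_dim_subspace (range (T n))) \<and>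
        (\<forall>x. (\<lambda>n. norm (x - T n x)) \<longlonglongrightarrow> 0) \<and>
        (\<forall>n m. T n \<circ> T m = T (min m n)))"

text \<open>
  \<open>compose_range P k l = P k \<circ> P (k + 1) \<circ> \<dots> \<circ> P l\<close> for \<open>k \<le> l\<close>; the last factor acts first.
\<close>

definition compose_range :: "(nat \<Rightarrow> 'a \<Rightarrow> 'a) \<Rightarrow> nat \<Rightarrow> nat \<Rightarrow> 'a \<Rightarrow> 'a" where
  "compose_range P k l = foldr P [k..<Suc l]"

end

theory Submission
  imports Defs
begin

text \<open>
  Both directions are perturbation arguments for finite-rank projections. Everything rests on two
  facts: a strongly convergent sequence of operators converges in norm on a finite-dimensional
  subspace (\<open>norm_convergence_on_finite_rank\<close>), and \<open>id + E\<close> is invertible with inverse of norm at most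
  \<open>2\<close> once \<open>norm E \<le> 1/2\<close> (\<open>perturbed_identity_inverse\<close>).

  Let the space have the \<open>\<pi>\<close>-property. By Banach--Steinhaus its projections \<open>T n\<close> are uniformly bounded.
  If \<open>T m\<close> almost fixes the range of a projection \<open>R\<close>, then \<open>A = id + (T m - id) R\<close> is invertible and the
  conjugate \<open>A\<inverse> (T m) A\<close> projects onto a space containing the range of \<open>R\<close>. Repeating this gives uniformly
  bounded projections with increasing ranges \<open>X i\<close> whose union is dense (\<open>increasing_projections\<close>).
  If along a subsequence of the \<open>X i\<close> some projections \<open>P n\<close> had uniformly bounded compositions
  \<open>P k \<circ> \<dots> \<circ> P l\<close>, these would for \<open>l\<close> tending to infinity define bounded commuting projections onto the
  members of the subsequence, that is, a finite-dimensional decomposition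
  (\<open>bounded_compositions_imp_FDD\<close>).

  Conversely, let \<open>X i\<close> be increasing with dense union and bounded projection constants. Uniformly bounded
  projections \<open>T i\<close> onto \<open>X i\<close> converge strongly to the identity, which is the \<open>\<pi>\<close>-property. Suppose there
  were a decomposition \<open>S n\<close>. Conjugating it with an operator close to the identity, one may assume that
  the range of every \<open>S n\<close> lies in some \<open>X i\<close> (\<open>FDD_with_ranges_in_dense_union\<close>). Interlacing a subsequence
  of the \<open>X i\<close> with a subsequence of these ranges, one corrects the projections onto the chosen \<open>X i\<close> by the
  \<open>S n\<close> in such a way that consecutive ones satisfy \<open>P n (P (n + 1)) = P n\<close>
  (\<open>commuting_projections_along_subsequence\<close>). Then the composition \<open>P k \<circ> \<dots> \<circ> P l\<close> equals \<open>P k\<close>, so the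
  compositions are uniformly bounded, contrary to the assumed unboundedness.
\<close>

section \<open>Bounded operators and dense subspaces\<close>

text \<open>
  The Banach--Steinhaus theorem for a sequence. By Baire's theorem one of the closed sets on which
  all \<open>T n\<close> are bounded by a fixed number contains a ball.
\<close>

lemma uniform_boundedness:
  fixes T :: "nat \<Rightarrow> 'a::banach \<Rightarrow>\<^sub>L 'b::real_normed_vector"
  assumes "\<And>x. \<exists>B. \<forall>n. norm (T n x) \<le> B"
  obtains C where "0 \<le> C" "\<And>n. norm (T n) \<le> C"
proof -
  define F where "F N = (\<Inter>n. {x. norm (T n x) \<le> real N})" for N :: nat
  have closed: "closed (F N)" for N
    unfolding F_def by (intro closed_INT ballI closed_Collect_le continuous_intros)
  have cover: "(\<Union>N. F N) = UNIV"
  proof -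
    have "\<exists>N. x \<in> F N" for x
    proof -
      obtain B where "\<And>n. norm (T n x) \<le> B" using assms by blast
      moreover obtain N where "B \<le> real N" using real_arch_simple by blast
      ultimately show ?thesis unfolding F_def by (auto intro: order_trans)
    qed
    then show ?thesis by blast
  qed
  have "\<exists>N. interior (F N) \<noteq> {}"
  proof (rule ccontr)
    assume "\<not> ?thesis"
    then have "euclidean interior_of \<Union>(range F) = {}"
      by (intro Baire_category_alt) (auto simp: closed completely_metrizable_space_euclidean)
    then show False using cover by simp
  qed
  then obtain N x e where e: "0 < e" "cball x e \<subseteq> F N"
    using interior_subset open_interior open_contains_cball by (metis equals0I order_trans)
  \<comment> \<open>A bound on one ball gives a bound on the unit ball, by translating and rescaling.\<close>
  have "norm (T n) \<le> 2 * real N / e" for n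
  proof (rule norm_blinfun_bound)
    fix y
    show "norm (T n y) \<le> 2 * real N / e * norm y"
    proof (cases "y = 0")
      case False
      define z where "z = (e / norm y) *\<^sub>R y"
      have "norm z = e" using False e by (simp add: z_def)
      then have "x + z \<in> F N" "x \<in> F N" using e by (auto simp: dist_norm subset_iff)
      then have "norm (T n (x + z)) \<le> N" "norm (T n x) \<le> N" by (auto simp: F_def)
      then have "norm (T n z) \<le> 2 * N"
        using norm_triangle_ineq4[of "T n (x + z)" "T n x"] by (simp add: blinfun.add_right)
      moreover have "norm (T n z) = e / norm y * norm (T n y)"
        using e by (simp add: z_def blinfun.scaleR_right)
      ultimately show ?thesis using e False by (simp add: field_simps)
    qed (simp add: blinfun.zero_right)
  qed (use e in simp)
  then show ?thesis using e by (intro that[of "2 * real N / e"]) auto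
qed

lemma convergent_imp_bounded_norm:
  fixes T :: "nat \<Rightarrow> 'a::banach \<Rightarrow>\<^sub>L 'b::real_normed_vector"
  assumes "\<And>x. (\<lambda>n. T n x) \<longlonglongrightarrow> L x"
  obtains C where "0 \<le> C" "\<And>n. norm (T n) \<le> C"
proof (rule uniform_boundedness[of T])
  fix x
  have "Bseq (\<lambda>n. T n x)" using assms convergentI convergent_imp_Bseq by blast
  then show "\<exists>B. \<forall>n. norm (T n x) \<le> B" by (auto simp: Bseq_def)
qed (use that in blast)

lemma strong_convergence_of_dense:
  fixes T :: "nat \<Rightarrow> 'a::real_normed_vector \<Rightarrow>\<^sub>L 'a"
  assumes C: "\<And>n. norm (T n) \<le> C"
    and dense: "closure U = UNIV"
    and conv: "\<And>u. u \<in> U \<Longrightarrow> (\<lambda>n. T n u) \<longlonglongrightarrow> u"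
  shows "(\<lambda>n. T n x) \<longlonglongrightarrow> x"
proof (rule LIMSEQ_I)
  fix r :: real assume "0 < r"
  have C0: "0 \<le> C" using C[of 0] norm_ge_zero order_trans by blast
  define d where "d = r / (2 * (C + 1))"
  have d: "0 < d" "(C + 1) * d = r / 2" using \<open>0 < r\<close> C0 by (auto simp: d_def field_simps)
  obtain u where u: "u \<in> U" "dist u x < d"
    using dense d(1) closure_approachable[of x U] by auto
  obtain N where N: "\<And>n. n \<ge> N \<Longrightarrow> norm (T n u - u) < r / 2"
    using LIMSEQ_D[OF conv[OF u(1)], of "r / 2"] \<open>0 < r\<close> by auto
  have "norm (T n x - x) < r" if "n \<ge> N" for n
  proof -
    have "T n x - x = T n (x - u) + (T n u - u) + (u - x)" by (simp add: blinfun.diff_right)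
    then have "norm (T n x - x) \<le> norm (T n (x - u)) + norm (T n u - u) + norm (u - x)"
      by (metis norm_triangle_ineq norm_triangle_le add_le_cancel_right order_trans)
    moreover have "norm (T n (x - u)) \<le> C * norm (x - u)"
      using norm_blinfun[of "T n" "x - u"] C[of n] by (meson mult_right_mono norm_ge_zero order_trans)
    moreover have "norm (x - u) \<le> d" using u(2) by (simp add: dist_norm norm_minus_commute)
    then have "(C + 1) * norm (x - u) \<le> (C + 1) * d" using C0 by (intro mult_left_mono) auto
    ultimately show ?thesis using N[OF that] d(2)
      by (simp add: norm_minus_commute[of u x] distrib_right)
  qed
  then show "\<exists>N. \<forall>n\<ge>N. norm (T n x - x) < r" by blast
qed

lemma blinfun_eq_on_dense:
  fixes f g :: "'a::real_normed_vector \<Rightarrow>\<^sub>L 'b::real_normed_vector"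
  assumes "closure U = UNIV" "\<And>u. u \<in> U \<Longrightarrow> f u = g u"
  shows "f = g"
proof (rule blinfun_eqI)
  fix x
  have "closed {x. f x = g x}" by (intro closed_Collect_eq continuous_intros)
  then have "closure U \<subseteq> {x. f x = g x}" using assms(2) by (intro closure_minimal) auto
  then show "f x = g x" using assms(1) by auto
qed

text \<open>
  A Lipschitz map extends uniformly continuously to the closure of its domain. Additivity,
  homogeneity and the norm bound are closed conditions, so they survive the extension.
\<close>

lemma bounded_linear_extension_from_dense:
  fixes f :: "'a::real_normed_vector \<Rightarrow> 'b::banach"
  assumes sub: "subspace U" and dense: "closure U = UNIV"
    and add: "\<And>x y. x \<in> U \<Longrightarrow> y \<in> U \<Longrightarrow> f (x + y) = f x + f y"
    and scale: "\<And>c x. x \<in> U \<Longrightarrow> f (c *\<^sub>R x) = c *\<^sub>R f x"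
    and bound: "\<And>x. x \<in> U \<Longrightarrow> norm (f x) \<le> M * norm x" and "0 \<le> M"
  obtains F :: "'a \<Rightarrow>\<^sub>L 'b" where "\<And>x. x \<in> U \<Longrightarrow> F x = f x" "norm F \<le> M"
proof -
  have diff: "f x - f y = f (x - y)" if "x \<in> U" "y \<in> U" for x y
    using add[OF that(1), of "-y"] scale[OF that(2), of "-1"] that sub by (simp add: subspace_neg)
  have "M-lipschitz_on U f"
    by (intro lipschitz_onI) (auto simp: dist_norm diff subspace_diff[OF sub] bound \<open>0 \<le> M\<close>)
  then obtain g where g: "uniformly_continuous_on (closure U) g" "\<And>x. x \<in> U \<Longrightarrow> f x = g x"
    using uniformly_continuous_on_extension_on_closure[OF lipschitz_on_uniformly_continuous] by metis
  have cont: "continuous_on UNIV g"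
    using g(1) uniformly_continuous_imp_continuous dense by force
  have cont': "continuous_on UNIV (\<lambda>x. g (h x))" if "continuous_on UNIV h" for h :: "'c::topological_space \<Rightarrow> 'a"
    using continuous_on_compose2[OF cont that] by auto
  have gadd: "g (x + y) = g x + g y" for x y
  proof -
    have "closed {z::'a \<times> 'a. g (fst z + snd z) = g (fst z) + g (snd z)}"
      by (intro closed_Collect_eq continuous_intros cont')
    then have "closure (U \<times> U) \<subseteq> {z::'a \<times> 'a. g (fst z + snd z) = g (fst z) + g (snd z)}"
      using g(2) add sub by (intro closure_minimal) (auto simp: subspace_add simp flip: g(2))
    moreover have "(x, y) \<in> closure (U \<times> U)" by (simp add: closure_Times dense)
    ultimately show ?thesis by auto
  qed
  have gscale: "g (c *\<^sub>R x) = c *\<^sub>R g x" for c x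
  proof -
    have "closed {x. g (c *\<^sub>R x) = c *\<^sub>R g x}"
      by (intro closed_Collect_eq continuous_intros cont')
    then have "closure U \<subseteq> {x. g (c *\<^sub>R x) = c *\<^sub>R g x}"
      using g(2) scale sub by (intro closure_minimal) (auto simp: subspace_scale simp flip: g(2))
    then show ?thesis using dense by auto
  qed
  have gbound: "norm (g x) \<le> M * norm x" for x
  proof -
    have "closed {x. norm (g x) \<le> M * norm x}"
      by (intro closed_Collect_le continuous_intros cont')
    then have "closure U \<subseteq> {x. norm (g x) \<le> M * norm x}"
      using g(2) bound by (intro closure_minimal) (auto simp flip: g(2))
    then show ?thesis using dense by auto
  qed
  have bl: "bounded_linear g"
    by (intro bounded_linear_intro[of _ M]) (auto simp: gadd gscale gbound mult.commute)
  show ?thesis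
    by (rule that[of "Blinfun g"])
      (auto simp: bounded_linear_Blinfun_apply[OF bl] g(2) gbound \<open>0 \<le> M\<close> intro!: norm_blinfun_bound)
qed

text \<open>
  The equation \<open>x + E x = y\<close> says that \<open>x\<close> is a fixed point of the contraction \<open>x \<mapsto> y - E x\<close>, so it has
  a unique solution, and \<open>norm (x + E x) \<ge> norm x / 2\<close> bounds the inverse.
\<close>

lemma perturbed_identity_inverse:
  fixes E :: "'a::banach \<Rightarrow>\<^sub>L 'a"
  assumes E: "norm E \<le> 1/2"
  obtains W :: "'a \<Rightarrow>\<^sub>L 'a"
  where "\<And>x. W (x + E x) = x" "\<And>y. W y + E (W y) = y" "norm W \<le> 2"
proof -
  have half: "norm (E x) \<le> norm x / 2" for x
    using norm_blinfun[of E x] mult_right_mono[OF E norm_ge_zero[of x]] by simp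
  have uniq: "\<exists>!x. x + E x = y" for y
  proof -
    have "\<exists>!x. y - E x = x"
    proof (rule banach_fix_type[of "1/2"])
      show "\<forall>x z. dist (y - E x) (y - E z) \<le> 1 / 2 * dist x z"
        using half[of "x - z" for x z]
        by (simp add: dist_norm blinfun.diff_right)
          (simp add: norm_minus_commute)
    qed auto
    then show ?thesis by (metis add_diff_cancel_right' diff_add_cancel)
  qed
  define w where "w y = (THE x. x + E x = y)" for y
  have w: "w y + E (w y) = y" for y unfolding w_def using theI'[OF uniq] by simp
  have w': "x = w y" if "x + E x = y" for x y using uniq w that by blast
  have "bounded_linear w"
  proof (rule bounded_linear_intro[of _ 2])
    show "w (x + y) = w x + w y" for x y
      by (rule w'[symmetric]) (use w[of x] w[of y] in \<open>simp add: blinfun.add_right algebra_simps\<close>)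
    show "w (r *\<^sub>R x) = r *\<^sub>R w x" for r x
      by (rule w'[symmetric]) (use w[of x] in \<open>simp add: blinfun.scaleR_right flip: scaleR_add_right\<close>)
    show "norm (w x) \<le> norm x * 2" for x
      using norm_diff_ineq[of "w x" "E (w x)"] half[of "w x"] w[of x] by simp
  qed
  note bl = bounded_linear_Blinfun_apply[OF this]
  show ?thesis
  proof (rule that[of "Blinfun w"])
    show "norm (Blinfun w) \<le> 2"
      using norm_diff_ineq[of "w x" "E (w x)" for x] half[of "w x" for x] w
      by (intro norm_blinfun_bound) (auto simp: bl, smt (verit))
  qed (auto simp: bl w w'[symmetric])
qed

section \<open>Finite-dimensional subspaces\<close>

text \<open>
  The coefficient of \<open>b\<close> is a bounded functional on the span of \<open>b\<close> and \<open>B\<close>, because \<open>b\<close> has positive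
  distance from the closed subspace spanned by \<open>B\<close>. This is the induction step in the two
  inductions over a finite spanning set below.
\<close>

lemma complete_span_imp_distance:
  fixes b :: "'a::banach"
  assumes "complete (span B)" "b \<notin> span B"
  obtains d where "0 < d" "\<And>c y. y \<in> span B \<Longrightarrow> d * \<bar>c\<bar> \<le> norm (c *\<^sub>R b + y)"
proof
  let ?d = "infdist b (span B)"
  show "0 < ?d"
    using assms span_zero[of B] by (intro infdist_pos_not_in_closed) (auto simp: complete_eq_closed)
  fix c :: real and y assume y: "y \<in> span B"
  show "?d * \<bar>c\<bar> \<le> norm (c *\<^sub>R b + y)"
  proof (cases "c = 0")
    case False
    have "?d \<le> dist b (- (y /\<^sub>R c))"
      using y by (intro infdist_le span_neg span_scale)
    also have "\<dots> = norm (c *\<^sub>R b + y) / \<bar>c\<bar>"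
    proof -
      have "b - - (y /\<^sub>R c) = (c *\<^sub>R b + y) /\<^sub>R c" using False by (simp add: scaleR_add_right)
      then show ?thesis by (simp add: dist_norm divide_inverse mult.commute)
    qed
    finally show ?thesis using False by (simp add: field_simps)
  qed simp
qed

lemma complete_span_finite:
  fixes B :: "'a::banach set"
  assumes "finite B"
  shows "complete (span B)"
  using assms
proof induction
  case empty
  show ?case by (simp add: complete_eq_closed)
next
  case (insert b B)
  show ?case
  proof (cases "b \<in> span B")
    case True
    then show ?thesis using insert.IH by (simp add: span_redundant)
  next
    case False
    obtain d where d: "0 < d" "\<And>c y. y \<in> span B \<Longrightarrow> d * \<bar>c\<bar> \<le> norm (c *\<^sub>R b + y)"
      using complete_span_imp_distance[OF insert.IH False] by blast
    show ?thesis
    proof (rule completeI)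
      fix f assume f: "\<forall>n. f n \<in> span (insert b B)" and Cau: "Cauchy f"
      from f have "\<forall>n. \<exists>c. f n - c *\<^sub>R b \<in> span B" by (simp add: span_insert)
      then obtain c where c: "\<And>n. f n - c n *\<^sub>R b \<in> span B" by metis
      have cd: "d * \<bar>c m - c n\<bar> \<le> norm (f m - f n)" for m n
        using d(2)[OF span_diff[OF c[of m] c[of n]], of "c m - c n"] by (simp add: algebra_simps)
      have "Cauchy c"
      proof (rule CauchyI)
        fix e :: real assume "0 < e"
        then obtain M where M: "\<And>m n. m \<ge> M \<Longrightarrow> n \<ge> M \<Longrightarrow> norm (f m - f n) < d * e"
          using CauchyD[OF Cau, of "d * e"] d(1) by auto
        have "norm (c m - c n) < e" if "m \<ge> M" "n \<ge> M" for m n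
          using le_less_trans[OF cd M[OF that]] d(1) by simp
        then show "\<exists>M. \<forall>m\<ge>M. \<forall>n\<ge>M. norm (c m - c n) < e" by blast
      qed
      then obtain c0 where c0: "c \<longlonglongrightarrow> c0" using Cauchy_convergent_iff convergent_def by blast
      obtain f0 where f0: "f \<longlonglongrightarrow> f0" using Cau Cauchy_convergent_iff convergent_def by blast
      have lim: "(\<lambda>n. f n - c n *\<^sub>R b) \<longlonglongrightarrow> f0 - c0 *\<^sub>R b" by (intro tendsto_intros f0 c0)
      have "closed (span B)" using insert.IH by (simp add: complete_eq_closed)
      then have "f0 - c0 *\<^sub>R b \<in> span B" by (rule closed_sequentially[OF _ c lim])
      then have "f0 \<in> span (insert b B)" by (auto simp: span_insert)
      with f0 show "\<exists>l\<in>span (insert b B). f \<longlonglongrightarrow> l" by blast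
    qed
  qed
qed

lemma finite_dim_subspace_closed:
  fixes S :: "'a::banach set"
  shows "finite_dim_subspace S \<Longrightarrow> closed S"
  using complete_span_finite by (auto simp: finite_dim_subspace_def simp flip: complete_eq_closed)

lemma finite_dim_subspace_imp_subspace: "finite_dim_subspace S \<Longrightarrow> subspace S"
  by (auto simp: finite_dim_subspace_def)

lemma finite_dim_subspace_image:
  "finite_dim_subspace S \<Longrightarrow> linear f \<Longrightarrow> finite_dim_subspace (f ` S)"
  unfolding finite_dim_subspace_def by (metis finite_imageI linear_span_image)

lemma finite_dim_subspace_in_increasing_union:
  fixes X :: "nat \<Rightarrow> 'a::real_vector set"
  assumes "finite_dim_subspace S" "\<And>i. X i \<subseteq> X (Suc i)" "\<And>i. subspace (X i)" "S \<subseteq> (\<Union>i. X i)"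
  obtains i where "S \<subseteq> X i"
proof -
  obtain B where B: "finite B" "S = span B" using assms(1) by (auto simp: finite_dim_subspace_def)
  have mono: "X i \<subseteq> X j" if "i \<le> j" for i j using that assms(2) by (rule lift_Suc_mono_le[rotated])
  have "\<forall>b\<in>B. \<exists>i. b \<in> X i" using B assms(4) span_base by blast
  then obtain g where g: "\<And>b. b \<in> B \<Longrightarrow> b \<in> X (g b)" by metis
  have "B \<subseteq> X (Max (insert 0 (g ` B)))"
  proof
    fix b assume "b \<in> B"
    then show "b \<in> X (Max (insert 0 (g ` B)))"
      using g mono[of "g b" "Max (insert 0 (g ` B))"] B(1) by fastforce
  qed
  then show ?thesis using that B(2) assms(3) by (metis span_minimal)
qed

text \<open>
  On a finite-dimensional subspace pointwise convergence is uniform on the unit ball. Adding one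
  vector \<open>b\<close> to the spanning set costs a fixed factor, since the coefficient of \<open>b\<close> in \<open>x\<close> is at most
  \<open>norm x / d\<close>.
\<close>

lemma uniform_convergence_on_finite_span:
  fixes G :: "nat \<Rightarrow> 'a::banach \<Rightarrow>\<^sub>L 'b::real_normed_vector"
  assumes "finite B" "\<And>b. b \<in> B \<Longrightarrow> (\<lambda>n. G n b) \<longlonglongrightarrow> 0" "0 < e"
  shows "\<forall>\<^sub>F n in sequentially. \<forall>x\<in>span B. norm (G n x) \<le> e * norm x"
  using assms
proof (induction arbitrary: e)
  case empty
  then show ?case by (simp)
next
  case (insert b B)
  show ?case
  proof (cases "b \<in> span B")
    case True
    then show ?thesis using insert by (simp add: span_redundant)
  next
    case False
    obtain d where d: "0 < d" "\<And>c y. y \<in> span B \<Longrightarrow> d * \<bar>c\<bar> \<le> norm (c *\<^sub>R b + y)"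
      using complete_span_imp_distance[OF complete_span_finite[OF insert.hyps(1)] False] by blast
    define K where "K = 1 + norm b / d"
    define e' where "e' = e / (2 * K)"
    have K: "0 < K" unfolding K_def using d(1) by (simp add: add_pos_nonneg)
    have e': "0 < e'" "e' * K = e / 2"
      unfolding e'_def using insert.prems(2) K by auto
    have ev1: "\<forall>\<^sub>F n in sequentially. \<forall>x\<in>span B. norm (G n x) \<le> e' * norm x"
      using insert.IH[OF insert.prems(1) e'(1)] by simp
    have ev2: "\<forall>\<^sub>F n in sequentially. norm (G n b) < e * d / 2"
      using insert.prems(2) d(1)
      by (intro order_tendstoD(2)[OF tendsto_norm_zero[OF insert.prems(1)[OF insertI1]]]) simp
    show ?thesis
      using ev1 ev2
    proof eventually_elim
      case (elim n)
      show ?case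
      proof
        fix x assume "x \<in> span (insert b B)"
        then obtain c where c: "x - c *\<^sub>R b \<in> span B" by (auto simp: span_insert)
        have cx: "\<bar>c\<bar> \<le> norm x / d" using d(2)[OF c, of c] d(1) by (simp add: field_simps)
        have "norm (x - c *\<^sub>R b) \<le> norm x + \<bar>c\<bar> * norm b"
          using norm_triangle_ineq4[of x "c *\<^sub>R b"] by simp
        also have "\<dots> \<le> norm x + norm x / d * norm b" using mult_right_mono[OF cx norm_ge_zero[of b]] by simp
        finally have y: "norm (x - c *\<^sub>R b) \<le> K * norm x" by (simp add: algebra_simps K_def)
        have "norm (G n (x - c *\<^sub>R b)) \<le> e' * norm (x - c *\<^sub>R b)" using elim(1) c by blast
        also have "\<dots> \<le> e' * (K * norm x)" using y e'(1) by (simp add: mult_left_mono)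
        also have "\<dots> = e / 2 * norm x" using e'(2) by (simp only: mult.assoc[symmetric])
        finally have 1: "norm (G n (x - c *\<^sub>R b)) \<le> e / 2 * norm x" .
        have "\<bar>c\<bar> * norm (G n b) \<le> norm x / d * (e * d / 2)"
          using cx elim(2) d(1) by (intro mult_mono) auto
        then have 2: "\<bar>c\<bar> * norm (G n b) \<le> e / 2 * norm x" using d(1) by (simp add: field_simps)
        have "G n x = G n (x - c *\<^sub>R b) + c *\<^sub>R G n b" by (simp add: blinfun.bilinear_simps)
        then have "norm (G n x) \<le> norm (G n (x - c *\<^sub>R b)) + \<bar>c\<bar> * norm (G n b)"
          by (metis norm_triangle_ineq norm_scaleR)
        then show "norm (G n x) \<le> e * norm x" using 1 2 by simp
      qed
    qed
  qed
qed

text \<open>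
  This converts the strong convergence in the definitions of the \<open>\<pi>\<close>-property and of decompositions into
  the operator norm estimates that all perturbations below rely on.
\<close>

lemma norm_convergence_on_finite_rank:
  fixes T :: "nat \<Rightarrow> 'a::banach \<Rightarrow>\<^sub>L 'a" and R :: "'b::real_normed_vector \<Rightarrow>\<^sub>L 'a"
  assumes conv: "\<And>x. (\<lambda>n. T n x) \<longlonglongrightarrow> x" and R: "finite_dim_subspace (range R)" and "0 < e"
  shows "\<forall>\<^sub>F n in sequentially. norm ((T n - id_blinfun) o\<^sub>L R) \<le> e"
proof -
  obtain B where B: "finite B" "range R = span B" using R by (auto simp: finite_dim_subspace_def)
  define e' where "e' = e / (norm R + 1)"
  have e': "0 < e'" "e' * norm R \<le> e"
    using \<open>0 < e\<close> by (auto simp: e'_def field_simps add_pos_nonneg add_nonneg_pos)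
  have "(\<lambda>n. (T n - id_blinfun) b) \<longlonglongrightarrow> 0" for b
    using conv[of b] by (simp add: blinfun.diff_left LIM_zero)
  then have "\<forall>\<^sub>F n in sequentially. \<forall>x\<in>span B. norm ((T n - id_blinfun) x) \<le> e' * norm x"
    by (intro uniform_convergence_on_finite_span B e')
  then show ?thesis
  proof eventually_elim
    case (elim n)
    show ?case
    proof (rule norm_blinfun_bound)
      fix x
      have "norm ((T n - id_blinfun) (R x)) \<le> e' * norm (R x)" using elim B(2) by blast
      also have "\<dots> \<le> e' * (norm R * norm x)"
        using e'(1) by (intro mult_left_mono norm_blinfun) auto
      also have "\<dots> \<le> e * norm x" using mult_right_mono[OF e'(2) norm_ge_zero[of x]] by (simp add: mult.assoc)
      finally show "norm (((T n - id_blinfun) o\<^sub>L R) x) \<le> e * norm x" by simp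
    qed (use \<open>0 < e\<close> in simp)
  qed
qed

section \<open>Increasing the ranges of finite-rank projections\<close>

definition finite_rank_projection :: "('a::real_normed_vector \<Rightarrow>\<^sub>L 'a) \<Rightarrow> bool" where
  "finite_rank_projection T \<longleftrightarrow> (\<forall>x. T (T x) = T x) \<and> finite_dim_subspace (range T)"

lemma finite_rank_projection_Blinfun:
  assumes "projection f" "finite_dim_subspace (range f)"
  shows "blinfun_apply (Blinfun f) = f" "finite_rank_projection (Blinfun f)"
proof -
  show f: "blinfun_apply (Blinfun f) = f"
    using assms(1) by (simp add: projection_def bounded_linear_Blinfun_apply)
  show "finite_rank_projection (Blinfun f)"
    using assms by (simp add: finite_rank_projection_def f projection_def fun_eq_iff)
qed

lemma projection_blinfun:
  "(\<And>x. T (T x) = T x) \<Longrightarrow> projection (blinfun_apply T)" for T :: "'a::real_normed_vector \<Rightarrow>\<^sub>L 'a"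
  by (auto simp: projection_def fun_eq_iff blinfun.bounded_linear_right)

lemma finite_rank_projection_fixes: "finite_rank_projection T \<Longrightarrow> y \<in> range T \<Longrightarrow> T y = y"
  by (auto simp: finite_rank_projection_def)

text \<open>
  The operators \<open>W\<close> and \<open>id + E\<close> are inverse to each other, so this is a similarity transform of \<open>T\<close>.
\<close>

lemma conjugate_projection:
  fixes T :: "'a::real_normed_vector \<Rightarrow>\<^sub>L 'a" and E W :: "'a \<Rightarrow>\<^sub>L 'a"
  assumes T: "finite_rank_projection T"
    and W: "\<And>x. W (x + E x) = x" "\<And>y. W y + E (W y) = y"
  shows "finite_rank_projection (W o\<^sub>L T o\<^sub>L (id_blinfun + E))"
    and "range (W o\<^sub>L T o\<^sub>L (id_blinfun + E)) = W ` range T"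
proof -
  have idem: "T (T x) = T x" for x using T by (simp add: finite_rank_projection_def)
  have surj: "range (id_blinfun + E) = UNIV"
    using W(2) by (auto simp: blinfun.add_left intro!: image_eqI[of _ _ "W x" for x])
  have "range (W o\<^sub>L T o\<^sub>L (id_blinfun + E)) = (\<lambda>x. W (T x)) ` range (id_blinfun + E)"
    by (simp add: image_image)
  then show range: "range (W o\<^sub>L T o\<^sub>L (id_blinfun + E)) = W ` range T"
    by (simp add: surj image_image)
  have "finite_dim_subspace (W ` range T)"
    using T by (auto simp: finite_rank_projection_def blinfun.bounded_linear_right
        intro!: finite_dim_subspace_image bounded_linear.linear)
  then show "finite_rank_projection (W o\<^sub>L T o\<^sub>L (id_blinfun + E))"
    by (simp only: finite_rank_projection_def range)
      (simp add: blinfun.add_left W idem)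
qed

text \<open>
  If \<open>T\<close> almost fixes the range of \<open>R\<close>, then \<open>A = id + (T - id) R\<close> is invertible and agrees with \<open>T\<close> on
  the range of \<open>R\<close>. Hence \<open>A\<close> maps the range of \<open>R\<close> into the range of \<open>T\<close>, and the conjugate
  \<open>A\<inverse> T A\<close> is a projection onto a space that contains the range of \<open>R\<close>. Its norm is controlled by that
  of \<open>T\<close> alone, so that the step can be iterated without loss.
\<close>

lemma enlarge_projection:
  fixes R T :: "'a::banach \<Rightarrow>\<^sub>L 'a"
  assumes R: "finite_rank_projection R" and T: "finite_rank_projection T"
    and small: "norm ((T - id_blinfun) o\<^sub>L R) \<le> e" "e \<le> 1/2" and C: "norm T \<le> C"
  obtains R' :: "'a \<Rightarrow>\<^sub>L 'a"
  where "finite_rank_projection R'" "range R \<subseteq> range R'" "norm R' \<le> 3 * C"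
    "\<forall>x. norm (R' x - x) \<le> 2 * (norm (T x - x) + (C + 1) * e * norm x)"
proof -
  define E where "E = (T - id_blinfun) o\<^sub>L R"
  have E: "norm E \<le> 1/2" "norm E \<le> e" using small by (auto simp: E_def)
  obtain W :: "'a \<Rightarrow>\<^sub>L 'a" where W: "\<And>x. W (x + E x) = x" "\<And>y. W y + E (W y) = y" "norm W \<le> 2"
    using perturbed_identity_inverse[OF E(1)] by blast
  define R' where "R' = W o\<^sub>L T o\<^sub>L (id_blinfun + E)"
  have idem: "R (R x) = R x" "T (T x) = T x" for x using R T by (simp_all add: finite_rank_projection_def)
  have C0: "0 \<le> C" using C norm_ge_zero order_trans by blast
  have TC: "norm (T x) \<le> C * norm x" for x
    using norm_blinfun[of T x] mult_right_mono[OF C norm_ge_zero[of x]] by simp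
  have WC: "norm (W x) \<le> 2 * norm x" for x
    using norm_blinfun[of W x] mult_right_mono[OF W(3) norm_ge_zero[of x]] by simp
  have EC: "norm (E x) \<le> e * norm x" for x
    using norm_blinfun[of E x] mult_right_mono[OF E(2) norm_ge_zero[of x]] by simp
  show ?thesis
  proof (rule that)
    show "finite_rank_projection R'" unfolding R'_def by (rule conjugate_projection[OF T W(1,2)])
    show "range R \<subseteq> range R'"
    proof
      fix x assume "x \<in> range R"
      then have "R x = x" using idem by auto
      \<comment> \<open>On the range of \<open>R\<close> the operator \<open>id + E\<close> is \<open>T\<close>.\<close>
      then have "x + E x = T x" by (simp add: E_def blinfun.diff_left)
      then have "x = W (T x)" using W(1)[of x] by simp
      then show "x \<in> range R'"
        unfolding R'_def conjugate_projection(2)[OF T W(1,2)] by blast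
    qed
    show "norm R' \<le> 3 * C"
    proof (rule norm_blinfun_bound)
      fix x
      have "norm (x + E x) \<le> 3/2 * norm x"
        using norm_triangle_ineq[of x "E x"] EC[of x] mult_right_mono[OF small(2) norm_ge_zero[of x]] by simp
      then have "C * norm (x + E x) \<le> C * (3/2 * norm x)" using C0 by (rule mult_left_mono)
      then show "norm (R' x) \<le> 3 * C * norm x"
        using WC[of "T (x + E x)"] TC[of "x + E x"] by (simp add: R'_def blinfun.add_left)
    qed (use C0 in simp)
    show "\<forall>x. norm (R' x - x) \<le> 2 * (norm (T x - x) + (C + 1) * e * norm x)"
    proof
      fix x
      have "R' x - x = W (T (x + E x) - (x + E x))"
        using W(1)[of x] by (simp add: R'_def blinfun.add_left blinfun.diff_right)
      also have "T (x + E x) - (x + E x) = (T x - x) + (T (E x) - E x)"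
        by (simp add: blinfun.add_right)
      finally have "norm (R' x - x) \<le> 2 * norm ((T x - x) + (T (E x) - E x))"
        using WC by simp
      moreover have "norm ((T x - x) + (T (E x) - E x)) \<le> norm (T x - x) + (norm (T (E x)) + norm (E x))"
        by (meson norm_triangle_le norm_triangle_ineq4 add_left_mono)
      moreover have "norm (T (E x)) + norm (E x) \<le> (C + 1) * norm (E x)"
        using TC[of "E x"] by (simp add: distrib_right)
      moreover have "(C + 1) * norm (E x) \<le> (C + 1) * (e * norm x)"
        using C0 EC by (intro mult_left_mono) auto
      ultimately show "norm (R' x - x) \<le> 2 * (norm (T x - x) + (C + 1) * e * norm x)"
        by (simp add: mult.assoc)
    qed
  qed
qed

text \<open>
  Iterate the previous lemma. The perturbation in step \<open>n\<close> has norm at most \<open>(1/2) ^ (n + 1)\<close>, so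
  the new projections still converge strongly to the identity.
\<close>

lemma increasing_projections:
  fixes T :: "nat \<Rightarrow> 'a::banach \<Rightarrow>\<^sub>L 'a"
  assumes T: "\<And>n. finite_rank_projection (T n)" and conv: "\<And>x. (\<lambda>n. T n x) \<longlonglongrightarrow> x"
  obtains R :: "nat \<Rightarrow> 'a \<Rightarrow>\<^sub>L 'a" and M
  where "\<And>n. finite_rank_projection (R n)" "\<And>n. range (R n) \<subseteq> range (R (Suc n))"
    "\<And>n. norm (R n) \<le> M" "\<And>x. (\<lambda>n. R n x) \<longlonglongrightarrow> x"
proof -
  obtain C where C: "0 \<le> C" "\<And>n. norm (T n) \<le> C"
    using convergent_imp_bounded_norm[OF conv] by blast
  define good where "good n R \<longleftrightarrow> finite_rank_projection R \<and> norm R \<le> 3 * C" for n :: nat and R :: "'a \<Rightarrow>\<^sub>L 'a"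
  \<comment> \<open>The index \<open>m \<ge> n\<close> and the decaying error term make the constructed sequence converge strongly.\<close>
  define next_to where "next_to n R R' \<longleftrightarrow> range R \<subseteq> range R' \<and>
      (\<exists>m\<ge>n. \<forall>x. norm (R' x - x) \<le> 2 * (norm (T m x - x) + (C + 1) * (1/2) ^ Suc n * norm x))"
    for n and R R' :: "'a \<Rightarrow>\<^sub>L 'a"
  have "\<exists>R. \<forall>n. good n (R n) \<and> next_to n (R n) (R (Suc n))"
  proof (rule dependent_nat_choice)
    have "norm (T 0) \<le> 3 * C" using C(1) C(2)[of 0] by linarith
    then show "\<exists>R. good 0 R" using T by (auto simp: good_def)
    fix R n assume "good n R"
    then have R: "finite_rank_projection R" by (simp add: good_def)
    then have "\<forall>\<^sub>F m in sequentially. norm ((T m - id_blinfun) o\<^sub>L R) \<le> (1/2) ^ Suc n"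
      by (intro norm_convergence_on_finite_rank conv) (auto simp: finite_rank_projection_def)
    then obtain N where "\<forall>m\<ge>N. norm ((T m - id_blinfun) o\<^sub>L R) \<le> (1/2) ^ Suc n"
      unfolding eventually_sequentially by blast
    then have "norm ((T (max n N) - id_blinfun) o\<^sub>L R) \<le> (1/2) ^ Suc n" by simp
    then obtain m where m: "m \<ge> n" "norm ((T m - id_blinfun) o\<^sub>L R) \<le> (1/2) ^ Suc n"
      using max.cobounded1 by blast
    have half: "(1/2::real) ^ Suc n \<le> 1/2" by (simp add: power_le_one)
    obtain R' :: "'a \<Rightarrow>\<^sub>L 'a" where R': "finite_rank_projection R'" "range R \<subseteq> range R'" "norm R' \<le> 3 * C"
      "\<forall>x. norm (R' x - x) \<le> 2 * (norm (T m x - x) + (C + 1) * (1/2) ^ Suc n * norm x)"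
      using enlarge_projection[OF R T m(2) half C(2)] .
    then have "good (Suc n) R'" "next_to n R R'"
      using m(1) unfolding good_def next_to_def by auto
    then show "\<exists>R'. good (Suc n) R' \<and> next_to n R R'" by blast
  qed
  then obtain R where R: "\<And>n. good n (R n)" "\<And>n. next_to n (R n) (R (Suc n))" by blast
  have "(\<lambda>n. R n x) \<longlonglongrightarrow> x" for x
  proof -
    have "\<exists>m. m \<ge> n \<and> norm (R (Suc n) x - x) \<le> 2 * (norm (T m x - x) + (C + 1) * (1/2) ^ Suc n * norm x)" for n
      using R(2)[of n] unfolding next_to_def by blast
    then obtain m where m: "\<And>n. m n \<ge> n"
      "\<And>n. norm (R (Suc n) x - x) \<le> 2 * (norm (T (m n) x - x) + (C + 1) * (1/2) ^ Suc n * norm x)"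
      by metis
    have "filterlim m at_top sequentially"
      by (rule filterlim_at_top_mono[OF filterlim_ident]) (simp add: m(1))
    then have "(\<lambda>n. T (m n) x) \<longlonglongrightarrow> x"
      by (rule filterlim_compose[OF conv])
    then have "(\<lambda>n. 2 * (norm (T (m n) x - x) + (C + 1) * (1/2) ^ Suc n * norm x))
        \<longlonglongrightarrow> 2 * (norm (x - x) + (C + 1) * 0 * norm x)"
      by (intro tendsto_add tendsto_mult tendsto_const tendsto_norm tendsto_diff
          LIMSEQ_Suc[OF LIMSEQ_power_zero]) auto
    then have "(\<lambda>n. R (Suc n) x - x) \<longlonglongrightarrow> 0"
      by (intro Lim_null_comparison[OF always_eventually[OF allI[OF m(2)]]]) simp
    then have "(\<lambda>n. R (Suc n) x) \<longlonglongrightarrow> x" by (rule LIM_zero_cancel)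
    then show ?thesis by (rule LIMSEQ_imp_Suc)
  qed
  then show ?thesis
    using R by (intro that[of R "3 * C"]) (simp_all add: good_def next_to_def)
qed

section \<open>Reformulation with bounded linear functions\<close>

lemma norm_diff_tendsto_zero_iff:
  fixes x :: "'a::real_normed_vector"
  shows "(\<lambda>n. norm (x - f n)) \<longlonglongrightarrow> 0 \<longleftrightarrow> f \<longlonglongrightarrow> x"
  by (simp add: norm_minus_commute[of x] tendsto_norm_zero_iff LIM_zero_iff)

lemma has_FDD_iff_blinfun:
  "has_FDD TYPE('a::real_normed_vector) \<longleftrightarrow>
     (\<exists>T :: nat \<Rightarrow> 'a \<Rightarrow>\<^sub>L 'a. (\<forall>n. finite_rank_projection (T n)) \<and> (\<forall>x. (\<lambda>n. T n x) \<longlonglongrightarrow> x) \<and>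
        (\<forall>n m x. T n (T m x) = T (min m n) x))"
  (is "?L \<longleftrightarrow> ?R")
proof
  assume ?L
  then obtain T :: "nat \<Rightarrow> 'a \<Rightarrow> 'a" where T: "\<And>n. projection (T n)" "\<And>n. finite_dim_subspace (range (T n))"
    "\<And>x. (\<lambda>n. norm (x - T n x)) \<longlonglongrightarrow> 0" "\<And>n m. T n \<circ> T m = T (min m n)"
    unfolding has_FDD_def by blast
  have eq: "blinfun_apply (Blinfun (T n)) = T n" "finite_rank_projection (Blinfun (T n))" for n
    by (rule finite_rank_projection_Blinfun[OF T(1,2)])+
  have "(\<lambda>n. T n x) \<longlonglongrightarrow> x" for x
    using T(3)[of x] by (simp only: norm_diff_tendsto_zero_iff)
  then show ?R
    using T(4) by (intro exI[of _ "\<lambda>n. Blinfun (T n)"]) (simp add: eq fun_eq_iff)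
next
  assume ?R
  then obtain T :: "nat \<Rightarrow> 'a \<Rightarrow>\<^sub>L 'a" where T: "\<And>n. finite_rank_projection (T n)"
    "\<And>x. (\<lambda>n. T n x) \<longlonglongrightarrow> x" "\<And>n m x. T n (T m x) = T (min m n) x" by blast
  have "(\<lambda>n. norm (x - T n x)) \<longlonglongrightarrow> 0" for x
    using T(2)[of x] by (simp only: norm_diff_tendsto_zero_iff)
  then show ?L
    unfolding has_FDD_def using T
    by (intro exI[of _ "\<lambda>n. blinfun_apply (T n)"])
      (auto simp: finite_rank_projection_def fun_eq_iff intro: projection_blinfun)
qed

lemma pi_property_iff_blinfun:
  "pi_property TYPE('a::real_normed_vector) \<longleftrightarrow>
     (\<exists>T :: nat \<Rightarrow> 'a \<Rightarrow>\<^sub>L 'a. (\<forall>n. finite_rank_projection (T n)) \<and> (\<forall>x. (\<lambda>n. T n x) \<longlonglongrightarrow> x))"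
  (is "?L \<longleftrightarrow> ?R")
proof
  assume ?L
  then obtain T :: "nat \<Rightarrow> 'a \<Rightarrow> 'a" where T: "\<And>n. projection (T n)" "\<And>n. finite_dim_subspace (range (T n))"
    "\<And>x. (\<lambda>n. norm (x - T n x)) \<longlonglongrightarrow> 0"
    unfolding pi_property_def by blast
  have eq: "blinfun_apply (Blinfun (T n)) = T n" "finite_rank_projection (Blinfun (T n))" for n
    by (rule finite_rank_projection_Blinfun[OF T(1,2)])+
  have "(\<lambda>n. T n x) \<longlonglongrightarrow> x" for x
    using T(3)[of x] by (simp only: norm_diff_tendsto_zero_iff)
  then show ?R
    by (intro exI[of _ "\<lambda>n. Blinfun (T n)"]) (simp add: eq)
next
  assume ?R
  then obtain T :: "nat \<Rightarrow> 'a \<Rightarrow>\<^sub>L 'a" where T: "\<And>n. finite_rank_projection (T n)"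
    "\<And>x. (\<lambda>n. T n x) \<longlonglongrightarrow> x" by blast
  have "(\<lambda>n. norm (x - T n x)) \<longlonglongrightarrow> 0" for x
    using T(2)[of x] by (simp only: norm_diff_tendsto_zero_iff)
  then show ?L
    unfolding pi_property_def using T
    by (intro exI[of _ "\<lambda>n. blinfun_apply (T n)"])
      (auto simp: finite_rank_projection_def intro: projection_blinfun)
qed

section \<open>From bounded compositions to a decomposition\<close>

lemma compose_range_same: "compose_range P k k = P k"
  by (simp add: compose_range_def fun_eq_iff)

lemma compose_range_Suc_right: "k \<le> l \<Longrightarrow> compose_range P k (Suc l) x = compose_range P k l (P (Suc l) x)"
  by (simp add: compose_range_def)

lemma compose_range_Suc_left: "k < l \<Longrightarrow> compose_range P k l x = P k (compose_range P (Suc k) l x)"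
  by (simp add: compose_range_def upt_rec[of k])

lemma compose_range_split:
  assumes "k \<le> m" "m < l"
  shows "compose_range P k l x = compose_range P k m (compose_range P (Suc m) l x)"
proof -
  have "[k..<Suc l] = [k..<Suc m] @ [Suc m..<Suc l]"
    using upt_add_eq_append[of k "Suc m" "l - m"] assms by simp
  then show ?thesis by (simp only: compose_range_def foldr_append comp_apply)
qed

text \<open>
  A chain of projections with uniformly bounded compositions comes from a decomposition. The composition
  \<open>P k \<circ> \<dots> \<circ> P l\<close> is defined on \<open>Y (l + 1)\<close>, and its value at a given vector does not change when
  \<open>l\<close> grows, because the additional factors fix that vector. So the compositions define, for each \<open>k\<close>,
  one map on the union of the spaces, which is bounded by \<open>M\<close> and extends to the whole space.
\<close>

locale bounded_projection_chain =
  fixes Y :: "nat \<Rightarrow> 'a::banach set" and P :: "nat \<Rightarrow> 'a \<Rightarrow> 'a" and M :: real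
  assumes fin: "\<And>n. finite_dim_subspace (Y n)"
    and dense: "closure (\<Union>n. Y n) = UNIV"
    and P: "\<And>n. projection_onto (Y (Suc n)) (Y n) (P n)"
    and bound: "\<And>k l x. k < l \<Longrightarrow> x \<in> Y (Suc l) \<Longrightarrow> norm (compose_range P k l x) \<le> M * norm x"
    and M: "0 \<le> M"
begin

lemma Y_mono: "i \<le> j \<Longrightarrow> Y i \<subseteq> Y j"
  by (rule lift_Suc_mono_le[of Y]) (use P in \<open>auto simp: projection_onto_def\<close>)

lemma Y_subspace: "subspace (Y n)"
  by (rule finite_dim_subspace_imp_subspace[OF fin])

lemma P_fix: "x \<in> Y n \<Longrightarrow> P n x = x"
  using P[of n] by (auto simp: projection_onto_def)

lemma compose_range_linear:
  assumes "k \<le> l"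
  shows "(\<forall>x\<in>Y (Suc l). compose_range P k l x \<in> Y k \<and>
      (\<forall>c. compose_range P k l (c *\<^sub>R x) = c *\<^sub>R compose_range P k l x)) \<and>
    (\<forall>x\<in>Y (Suc l). \<forall>y\<in>Y (Suc l). compose_range P k l (x + y) = compose_range P k l x + compose_range P k l y)"
  using assms
proof (induction l rule: dec_induct)
  case base
  show ?case using P[of k] by (auto simp: compose_range_same projection_onto_def)
next
  case (step l)
  have "P (Suc l) z \<in> Y (Suc l)" if "z \<in> Y (Suc (Suc l))" for z
    using P[of "Suc l"] that by (auto simp: projection_onto_def)
  then show ?case
    using step P[of "Suc l"] by (simp add: compose_range_Suc_right projection_onto_def)
qed

lemma compose_range_stable:
  assumes "k \<le> l" "x \<in> Y (Suc l)" "l \<le> l'"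
  shows "compose_range P k l' x = compose_range P k l x"
  using assms(3)
proof (induction l' rule: dec_induct)
  case (step m)
  have "x \<in> Y (Suc m)" using assms(2) Y_mono[of "Suc l" "Suc m"] step by auto
  then show ?case using step assms(1) by (simp add: compose_range_Suc_right P_fix)
qed simp

lemma compose_range_fix:
  assumes "k \<le> l" "x \<in> Y k"
  shows "compose_range P k l x = x"
  using compose_range_stable[of k k x l] assms Y_mono[of k "Suc k"] by (auto simp: compose_range_same P_fix)

text \<open>
  Every admissible index \<open>l\<close> gives the same value; the least one is only a canonical choice.
\<close>

definition eventual_composition :: "nat \<Rightarrow> 'a \<Rightarrow> 'a" where
  "eventual_composition k x = compose_range P k (LEAST l. k < l \<and> x \<in> Y (Suc l)) x"

lemma eventual_composition_eq:
  assumes "k \<le> l" "x \<in> Y (Suc l)"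
  shows "eventual_composition k x = compose_range P k l x"
proof -
  let ?m = "LEAST l. k < l \<and> x \<in> Y (Suc l)"
  have "k < Suc l \<and> x \<in> Y (Suc (Suc l))" using assms Y_mono[of "Suc l" "Suc (Suc l)"] by auto
  then have m: "k < ?m" "x \<in> Y (Suc ?m)" by (rule LeastI2; blast)+
  show ?thesis
    unfolding eventual_composition_def
    using compose_range_stable[of k ?m x "max l ?m"] compose_range_stable[of k l x "max l ?m"] m assms by simp
qed

lemma ex_common_index:
  assumes "x \<in> (\<Union>n. Y n)" "y \<in> (\<Union>n. Y n)"
  obtains l where "k < l" "x \<in> Y (Suc l)" "y \<in> Y (Suc l)"
proof -
  obtain i j where ij: "x \<in> Y i" "y \<in> Y j" using assms by blast
  let ?l = "Suc (k + i + j)"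
  have "x \<in> Y (Suc ?l)" "y \<in> Y (Suc ?l)" using ij Y_mono[of i "Suc ?l"] Y_mono[of j "Suc ?l"] by auto
  then show ?thesis using that[of ?l] by auto
qed

lemma union_subspace: "subspace (\<Union>n. Y n)"
proof (rule subspaceI)
  show "0 \<in> (\<Union>n. Y n)" using subspace_0[OF Y_subspace] by blast
  show "x + y \<in> (\<Union>n. Y n)" if xy: "x \<in> (\<Union>n. Y n)" "y \<in> (\<Union>n. Y n)" for x y
  proof -
    obtain l where "x \<in> Y (Suc l)" "y \<in> Y (Suc l)" using ex_common_index[OF xy] .
    then show ?thesis using subspace_add[OF Y_subspace] by blast
  qed
  show "c *\<^sub>R x \<in> (\<Union>n. Y n)" if "x \<in> (\<Union>n. Y n)" for c x
    using that subspace_scale[OF Y_subspace] by blast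
qed

lemma eventual_composition_extension:
  obtains F :: "'a \<Rightarrow>\<^sub>L 'a"
  where "norm F \<le> M" "\<forall>l x. k \<le> l \<longrightarrow> x \<in> Y (Suc l) \<longrightarrow> F x = compose_range P k l x"
proof -
  let ?Q = "eventual_composition k"
  obtain F :: "'a \<Rightarrow>\<^sub>L 'a" where F: "\<And>x. x \<in> (\<Union>n. Y n) \<Longrightarrow> F x = ?Q x" "norm F \<le> M"
  proof (rule bounded_linear_extension_from_dense[OF union_subspace dense, of ?Q M])
    fix x y assume xy: "x \<in> (\<Union>n. Y n)" "y \<in> (\<Union>n. Y n)"
    obtain l where l: "k < l" "x \<in> Y (Suc l)" "y \<in> Y (Suc l)" using ex_common_index[OF xy] .
    then show "?Q (x + y) = ?Q x + ?Q y"
      using eventual_composition_eq[of k l] compose_range_linear[of k l] subspace_add[OF Y_subspace] by simp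
  next
    fix c x assume x: "x \<in> (\<Union>n. Y n)"
    obtain l where l: "k < l" "x \<in> Y (Suc l)" using ex_common_index[OF x x] .
    then show "?Q (c *\<^sub>R x) = c *\<^sub>R ?Q x"
      using eventual_composition_eq[of k l] compose_range_linear[of k l] subspace_scale[OF Y_subspace] by simp
  next
    fix x assume x: "x \<in> (\<Union>n. Y n)"
    obtain l where l: "k < l" "x \<in> Y (Suc l)" using ex_common_index[OF x x] .
    then show "norm (?Q x) \<le> M * norm x" using eventual_composition_eq[of k l] bound by simp
  qed (use M in auto)
  show ?thesis
  proof (rule that[OF F(2)], intro allI impI)
    fix l x assume "k \<le> l" "x \<in> Y (Suc l)"
    then show "F x = compose_range P k l x" using F(1)[of x] eventual_composition_eq by auto
  qed
qed

text \<open>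
  The extended maps \<open>F k\<close> project onto \<open>Y k\<close>. For \<open>k \<le> j\<close> the map \<open>F j\<close> fixes the range of \<open>F k\<close>; for \<open>j < k\<close> the
  product \<open>F j \<circ> F k\<close> is \<open>P j \<circ> \<dots> \<circ> P (k - 1)\<close> followed on the right by \<open>P k \<circ> \<dots> \<circ> P l\<close>, which is \<open>F j\<close>.
\<close>

lemma FDD: "has_FDD TYPE('a)"
proof -
  have "\<forall>k. \<exists>F :: 'a \<Rightarrow>\<^sub>L 'a. norm F \<le> M \<and>
      (\<forall>l x. k \<le> l \<longrightarrow> x \<in> Y (Suc l) \<longrightarrow> blinfun_apply F x = compose_range P k l x)"
    using eventual_composition_extension by blast
  then obtain F :: "nat \<Rightarrow> 'a \<Rightarrow>\<^sub>L 'a" where F: "\<And>k. norm (F k) \<le> M"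
    "\<And>k l x. k \<le> l \<Longrightarrow> x \<in> Y (Suc l) \<Longrightarrow> F k x = compose_range P k l x" by metis
  have fix_Y: "F k x = x" if "x \<in> Y k" for k x
    using F(2)[of k k x] that Y_mono[of k "Suc k"] by (auto simp: compose_range_same P_fix)
  have in_Y: "F k x \<in> Y k" for k x
  proof -
    have "closed (F k -` Y k)"
      using finite_dim_subspace_closed[OF fin] by (intro closed_vimage continuous_intros)
    moreover have "u \<in> F k -` Y k" if u: "u \<in> (\<Union>n. Y n)" for u
    proof -
      obtain l where "k < l" "u \<in> Y (Suc l)" using ex_common_index[OF u u] .
      then show ?thesis using F(2)[of k l u] compose_range_linear[of k l] by simp
    qed
    ultimately have "closure (\<Union>n. Y n) \<subseteq> F k -` Y k" by (intro closure_minimal) auto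
    then show ?thesis using dense by auto
  qed
  have range: "range (F k) = Y k" for k using in_Y fix_Y by (metis image_subsetI rangeI subsetI subset_antisym)
  have frp: "finite_rank_projection (F k)" for k
    using fin in_Y fix_Y by (simp add: finite_rank_projection_def range)
  have comp: "F j (F k x) = F (min k j) x" for j k x
  proof (cases "k \<le> j")
    case True
    then show ?thesis using fix_Y[of "F k x" j] in_Y[of k x] Y_mono[of k j] by (auto simp: min_def)
  next
    case False
    have "F j o\<^sub>L F k = F j"
    proof (rule blinfun_eq_on_dense[OF dense])
      fix u assume u: "u \<in> (\<Union>n. Y n)"
      obtain l where l: "k < l" "u \<in> Y (Suc l)" using ex_common_index[OF u u] .
      obtain k' where k': "k = Suc k'" "j \<le> k'" using False by (cases k) auto
      have "F j (F k u) = compose_range P j k' (F k u)" using F(2)[of j k' "F k u"] k' in_Y by auto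
      also have "\<dots> = compose_range P j k' (compose_range P k l u)" using F(2)[of k l u] l by simp
      also have "\<dots> = compose_range P j l u" using compose_range_split[of j k' l P u] k' l by simp
      also have "\<dots> = F j u" using F(2)[of j l u] l False by simp
      finally show "(F j o\<^sub>L F k) u = F j u" by simp
    qed
    then have "F j (F k x) = F j x" by (metis blinfun_apply_blinfun_compose)
    then show ?thesis using False by (simp add: min_def)
  qed
  have "(\<lambda>n. F n x) \<longlonglongrightarrow> x" for x
  proof (rule strong_convergence_of_dense[OF F(1) dense])
    fix u assume "u \<in> (\<Union>n. Y n)"
    then obtain i where i: "u \<in> Y i" by blast
    have "F n u = u" if "n \<ge> i" for n using fix_Y Y_mono[OF that] i by blast
    then show "(\<lambda>n. F n u) \<longlonglongrightarrow> u"
      by (intro tendsto_eventually) (auto simp: eventually_sequentially)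
  qed
  then show ?thesis using frp comp unfolding has_FDD_iff_blinfun by blast
qed

end

section \<open>From a decomposition to bounded compositions\<close>

text \<open>
  Let \<open>D n\<close> be the difference projections of the decomposition. Approximate each of them
  by \<open>T (i n) \<circ> D n\<close>, whose range lies in \<open>U\<close>, with an error \<open>e n\<close> of norm at most
  \<open>(1/2) ^ (n + 2)\<close>. The errors add up to an operator \<open>E\<close> of norm at most \<open>1/2\<close>, so \<open>V = id + E\<close> is
  invertible. As \<open>V\<close> replaces each \<open>D j x\<close> by \<open>T (i j) (D j x)\<close>, it maps the range of \<open>S n\<close>, which is
  the sum of the ranges of \<open>D 0, \<dots>, D n\<close>, into \<open>U\<close>. The conjugates \<open>V (S n) V\<inverse>\<close> form the required
  decomposition.
\<close>

lemma FDD_with_ranges_in_dense_union: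
  fixes S T :: "nat \<Rightarrow> 'a::banach \<Rightarrow>\<^sub>L 'a"
  assumes S: "\<And>n. finite_rank_projection (S n)" "\<And>x. (\<lambda>n. S n x) \<longlonglongrightarrow> x"
      "\<And>n m x. S n (S m x) = S (min m n) x"
    and T: "\<And>x. (\<lambda>n. T n x) \<longlonglongrightarrow> x"
    and U: "subspace U" "\<And>n. range (T n) \<subseteq> U"
  obtains S' :: "nat \<Rightarrow> 'a \<Rightarrow>\<^sub>L 'a"
  where "\<And>n. finite_rank_projection (S' n)" "\<And>x. (\<lambda>n. S' n x) \<longlonglongrightarrow> x"
      "\<And>n m x. S' n (S' m x) = S' (min m n) x" "\<And>n. range (S' n) \<subseteq> U"
proof -
  \<comment> \<open>The product form of \<open>S (Suc k) - S k\<close> shows that its range is finite-dimensional.\<close>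
  define D where "D n = (case n of 0 \<Rightarrow> S 0 | Suc k \<Rightarrow> (id_blinfun - S k) o\<^sub>L S (Suc k))" for n
  have D: "D 0 x = S 0 x" "D (Suc k) x = S (Suc k) x - S k x" for k x
    using S(3)[of k "Suc k" x] by (simp_all add: D_def blinfun.diff_left)
  have D_fin: "finite_dim_subspace (range (D n))" for n
  proof (cases n)
    case 0
    then show ?thesis using S(1) by (simp add: D_def finite_rank_projection_def)
  next
    case (Suc k)
    have "range (D n) = (id_blinfun - S k) ` range (S n)" by (simp add: Suc D_def image_image)
    then show ?thesis
      using S(1)[of n] by (auto simp: finite_rank_projection_def blinfun.bounded_linear_right
          intro!: finite_dim_subspace_image bounded_linear.linear)
  qed
  have D_sum: "(\<Sum>j\<le>n. D j x) = S n x" for n x by (induction n) (simp_all add: D)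
  have D_S: "D j (S n x) = (if j \<le> n then D j x else 0)" for j n x
    by (cases j) (auto simp: D S(3) min_def not_less_eq_eq)
  have "\<exists>i. norm ((T i - id_blinfun) o\<^sub>L D n) \<le> (1/2) ^ Suc (Suc n)" for n
    using eventually_happens'[OF sequentially_bot
        norm_convergence_on_finite_rank[OF T D_fin[of n], of "(1/2) ^ Suc (Suc n)"]] by simp
  then obtain i where i: "\<And>n. norm ((T (i n) - id_blinfun) o\<^sub>L D n) \<le> (1/2) ^ Suc (Suc n)" by metis
  define e where "e n = (T (i n) - id_blinfun) o\<^sub>L D n" for n
  have e: "norm (e n) \<le> (1/2) ^ Suc (Suc n)" for n using i by (simp add: e_def)
  have sums: "(\<lambda>n. (1/2::real) ^ Suc (Suc n)) sums (1/2)"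
    using sums_mult[OF geometric_sums[of "1/2::real"], of "1/4"] by simp
  have summable: "summable e"
    by (rule summable_comparison_test'[OF sums_summable[OF sums]]) (rule e)
  define E where "E = suminf e"
  have "norm E \<le> (\<Sum>n. (1/2) ^ Suc (Suc n))"
    unfolding E_def by (rule norm_suminf_le[OF e sums_summable[OF sums]])
  then have "norm E \<le> 1/2" using sums_unique[OF sums] by simp
  then obtain W :: "'a \<Rightarrow>\<^sub>L 'a" where W: "\<And>x. W (x + E x) = x" "\<And>y. W y + E (W y) = y"
    using perturbed_identity_inverse by blast
  have E_apply: "E x = (\<Sum>n. e n x)" for x
    unfolding E_def by (rule bounded_linear.suminf[OF blinfun.bounded_linear_left summable])
  \<comment> \<open>The sum is finite because \<open>e j\<close> vanishes on the range of \<open>S n\<close> for \<open>j > n\<close>.\<close>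
  have V_S: "S n x + E (S n x) = (\<Sum>j\<le>n. T (i j) (D j x))" for n x
  proof -
    have "E (S n x) = (\<Sum>j\<le>n. e j (S n x))"
      unfolding E_apply by (rule suminf_finite) (auto simp: e_def D_S)
    also have "\<dots> = (\<Sum>j\<le>n. T (i j) (D j x) - D j x)"
      by (intro sum.cong) (auto simp: e_def D_S blinfun.diff_left)
    finally show ?thesis by (simp add: sum_subtractf D_sum)
  qed
  define V where "V = id_blinfun + E"
  have WV: "W (V x) = x" "V (W x) = x" for x using W by (simp_all add: V_def blinfun.add_left)
  define S' where "S' n = V o\<^sub>L S n o\<^sub>L W" for n
  \<comment> \<open>The roles of the two inverse operators are exchanged: \<open>W\<close> is written as a perturbation of the identity.\<close>
  have cond: "V (x + (W - id_blinfun) x) = x" "V y + (W - id_blinfun) (V y) = y" for x y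
    using WV by (simp_all add: blinfun.diff_left)
  have fin: "finite_rank_projection (S' n)" for n
    using conjugate_projection(1)[OF S(1)[of n] cond] by (simp add: S'_def)
  have conv: "(\<lambda>n. S' n x) \<longlonglongrightarrow> x" for x
    using blinfun.tendsto[OF tendsto_const[of V] S(2)[of "W x"]] by (simp add: S'_def WV)
  have comm: "S' n (S' m x) = S' (min m n) x" for n m x by (simp add: S'_def WV S(3))
  have "S' n x \<in> U" for n x
    using U V_S[of n "W x"] by (auto simp: S'_def V_def blinfun.add_left intro!: subspace_sum)
  then have "range (S' n) \<subseteq> U" for n by blast
  with fin conv comm show ?thesis using that[of S'] by presburger
qed

text \<open>
  Choose indices alternately, so that \<open>S (m n)\<close> almost fixes \<open>X (t n)\<close> and has its range inside \<open>X (t (n + 1))\<close>.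
  Then \<open>A = id + (S (m n) - id) T (t n)\<close> is invertible and equals \<open>S (m n)\<close> on \<open>X (t n)\<close>, so
  \<open>B n = T (t n) A\<inverse> S (m n)\<close> is a projection onto \<open>X (t n)\<close> that factors through \<open>S (m n)\<close> on the right.
  These projections need not commute. The correction
  \<open>P n = S + (id - S) (B (n + 1)) (id - S)\<close> with \<open>S = S (m n)\<close> still projects onto \<open>X (t (n + 1))\<close>, since this space
  contains the range of \<open>S\<close>, and satisfies both \<open>S (P n) = S\<close> and \<open>P n (S (m (n + 1))) = P n\<close>. Hence
  \<open>P n (P (n + 1)) = P n (S (m (n + 1))) (P (n + 1)) = P n (S (m (n + 1))) = P n\<close>, and
  every composition \<open>P k \<circ> \<dots> \<circ> P l\<close> is just \<open>P k\<close>.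
\<close>

lemma commuting_projections_along_subsequence:
  fixes S T :: "nat \<Rightarrow> 'a::banach \<Rightarrow>\<^sub>L 'a" and X :: "nat \<Rightarrow> 'a set"
  assumes S: "\<And>n. finite_rank_projection (S n)" "\<And>x. (\<lambda>n. S n x) \<longlonglongrightarrow> x"
      "\<And>n m x. S n (S m x) = S (min m n) x" "\<And>n. range (S n) \<subseteq> (\<Union>i. X i)"
    and T: "\<And>n. finite_rank_projection (T n)" "\<And>n. range (T n) = X n" "\<And>n. norm (T n) \<le> M"
    and X: "\<And>n. X n \<subseteq> X (Suc n)"
  obtains s :: "nat \<Rightarrow> nat" and P :: "nat \<Rightarrow> 'a \<Rightarrow>\<^sub>L 'a" and C
  where "strict_mono s" "\<And>n. range (P n) \<subseteq> X (s n)" "\<And>n x. x \<in> X (s n) \<Longrightarrow> P n x = x"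
    "\<And>n x. P n (P (Suc n) x) = P n x" "\<And>n. norm (P n) \<le> C"
proof -
  have X_sub: "subspace (X n)" for n
    using T(1)[of n] T(2)[of n] finite_dim_subspace_imp_subspace by (auto simp: finite_rank_projection_def)
  have T_fix: "T n x = x" if "x \<in> X n" for n x
    using finite_rank_projection_fixes[OF T(1)] T(2) that by blast
  have T_in: "T n x \<in> X n" for n x using T(2)[of n] by blast
  obtain K where K: "0 \<le> K" "\<And>n. norm (S n) \<le> K"
    using convergent_imp_bounded_norm[OF S(2)] by blast
  have M: "0 \<le> M" using T(3)[of 0] norm_ge_zero order_trans by blast
  define good where "good n p \<longleftrightarrow> norm ((S (snd p) - id_blinfun) o\<^sub>L T (fst p)) \<le> 1/2"
    for n :: nat and p :: "nat \<times> nat"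
  define next_to where "next_to n p q \<longleftrightarrow> fst p < fst q \<and> snd p \<le> snd q \<and> range (S (snd p)) \<subseteq> X (fst q)"
    for n :: nat and p q :: "nat \<times> nat"
  have ex_good: "\<exists>m\<ge>m0. good n (i, m)" for n i m0
  proof -
    have "\<forall>\<^sub>F m in sequentially. norm ((S m - id_blinfun) o\<^sub>L T i) \<le> 1/2"
      using T(1)[of i] by (intro norm_convergence_on_finite_rank S) (auto simp: finite_rank_projection_def)
    then obtain N where "\<forall>m\<ge>N. norm ((S m - id_blinfun) o\<^sub>L T i) \<le> 1/2"
      unfolding eventually_sequentially by blast
    then show ?thesis by (intro exI[of _ "max m0 N"]) (simp add: good_def)
  qed
  have "\<exists>f. \<forall>n. good n (f n) \<and> next_to n (f n) (f (Suc n))"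
  proof (rule dependent_nat_choice)
    show "\<exists>p. good 0 p" using ex_good by blast
    fix p n assume "good n p"
    obtain i where i: "range (S (snd p)) \<subseteq> X i"
      using finite_dim_subspace_in_increasing_union[of "range (S (snd p))" X] S X X_sub
      by (auto simp: finite_rank_projection_def)
    define j where "j = max i (Suc (fst p))"
    have "X i \<subseteq> X j" by (rule lift_Suc_mono_le[of X]) (auto simp: X j_def)
    moreover obtain m where "m \<ge> snd p" "good (Suc n) (j, m)" using ex_good by blast
    ultimately have "good (Suc n) (j, m)" "next_to n p (j, m)"
      using i by (auto simp: next_to_def j_def)
    then show "\<exists>q. good (Suc n) q \<and> next_to n p q" by blast
  qed
  then obtain f where f: "\<And>n. good n (f n)" "\<And>n. next_to n (f n) (f (Suc n))" by blast
  define t where "t n = fst (f n)" for n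
  define m where "m n = snd (f n)" for n
  have t: "t n < t (Suc n)" and m: "m n \<le> m (Suc n)" and S_in: "S (m n) x \<in> X (t (Suc n))"
    and close: "norm ((S (m n) - id_blinfun) o\<^sub>L T (t n)) \<le> 1/2" for n x
    using f(1)[of n] f(2)[of n] by (auto simp: good_def next_to_def t_def m_def)
  define G where "G n = (S (m n) - id_blinfun) o\<^sub>L T (t n)" for n
  have "\<exists>W :: 'a \<Rightarrow>\<^sub>L 'a. norm W \<le> 2 \<and> (\<forall>x. blinfun_apply W (x + G n x) = x)" for n
  proof -
    have "norm (G n) \<le> 1/2" using close by (simp add: G_def)
    then obtain W :: "'a \<Rightarrow>\<^sub>L 'a" where "\<And>x. W (x + G n x) = x" "norm W \<le> 2"
      using perturbed_identity_inverse by blast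
    then show ?thesis by blast
  qed
  then have "\<exists>W :: nat \<Rightarrow> 'a \<Rightarrow>\<^sub>L 'a. \<forall>n. norm (W n) \<le> 2 \<and> (\<forall>x. blinfun_apply (W n) (x + G n x) = x)"
    by (intro choice) blast
  then obtain W :: "nat \<Rightarrow> 'a \<Rightarrow>\<^sub>L 'a" where W: "\<And>n. norm (W n) \<le> 2" "\<And>n x. W n (x + G n x) = x"
    by blast
  define B where "B n = T (t n) o\<^sub>L W n o\<^sub>L S (m n)" for n
  have B_fix: "B n x = x" if "x \<in> X (t n)" for n x
    using W(2)[of n x] T_fix[OF that] by (simp add: B_def G_def blinfun.diff_left)
  have B_in: "B n x \<in> X (t n)" for n x by (simp add: B_def T_in)
  have B_S: "B n (S (m n) x) = B n x" for n x by (simp add: B_def S(3))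
  have B_norm: "norm (B n) \<le> M * 2 * K" for n
  proof -
    have "norm (B n) \<le> norm (T (t n)) * norm (W n) * norm (S (m n))"
      unfolding B_def by (meson norm_blinfun_compose mult_right_mono norm_ge_zero order_trans)
    also have "\<dots> \<le> M * 2 * K"
      using T(3) W(1) K M by (intro mult_mono mult_nonneg_nonneg) auto
    finally show ?thesis .
  qed
  define P where "P n = S (m n) + ((id_blinfun - S (m n)) o\<^sub>L B (Suc n) o\<^sub>L (id_blinfun - S (m n)))" for n
  \<comment> \<open>The correction involves the stage before, so the subsequence starts at the second stage.\<close>
  define s where "s n = t (Suc n)" for n
  have P_apply: "P n x = S (m n) x + (B (Suc n) (x - S (m n) x) - S (m n) (B (Suc n) (x - S (m n) x)))" for n x
    by (simp add: P_def blinfun.add_left blinfun.diff_left)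
  have P_in: "P n x \<in> X (s n)" for n x
    unfolding P_apply s_def by (intro subspace_add subspace_diff X_sub S_in B_in)
  have P_fix: "P n x = x" if "x \<in> X (s n)" for n x
  proof -
    have "x - S (m n) x \<in> X (t (Suc n))" using that X_sub S_in by (auto simp: s_def intro: subspace_diff)
    then have "B (Suc n) (x - S (m n) x) = x - S (m n) x" by (rule B_fix)
    then show ?thesis by (simp only: P_apply) (simp add: blinfun.diff_right S(3))
  qed
  have S_P: "S (m n) (P n x) = S (m n) x" for n x
    by (simp add: P_apply blinfun.add_right blinfun.diff_right S(3))
  have P_S: "P n (S (m (Suc n)) x) = P n x" for n x
    using m[of n] by (simp add: P_apply blinfun.diff_right S(3) B_S min_def)
  have P_P: "P n (P (Suc n) x) = P n x" for n x
    using P_S[of n "P (Suc n) x"] P_S[of n x] S_P[of "Suc n" x] by simp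
  have P_norm: "norm (P n) \<le> K + (1 + K) * (M * 2 * K) * (1 + K)" for n
  proof -
    have I: "norm (id_blinfun - S (m n)) \<le> 1 + K"
      using norm_triangle_ineq4[of id_blinfun "S (m n)"] norm_blinfun_id_le K(2)[of "m n"]
      by (meson add_mono order_trans)
    have "norm ((id_blinfun - S (m n)) o\<^sub>L B (Suc n) o\<^sub>L (id_blinfun - S (m n)))
        \<le> norm (id_blinfun - S (m n)) * norm (B (Suc n)) * norm (id_blinfun - S (m n))"
      by (meson norm_blinfun_compose mult_right_mono norm_ge_zero order_trans)
    also have "\<dots> \<le> (1 + K) * (M * 2 * K) * (1 + K)"
      using I B_norm K M by (intro mult_mono mult_nonneg_nonneg) auto
    finally show ?thesis unfolding P_def using K(2)[of "m n"] by (intro norm_triangle_mono)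
  qed
  have "strict_mono s" using t by (simp add: strict_mono_Suc_iff s_def)
  then show ?thesis
    using P_in P_fix P_P P_norm by (intro that[of s P]) auto
qed

section \<open>The characterization\<close>

text \<open>
  The supremum of extended reals becomes a pointwise inequality with a real constant. At the zero
  vector the quotient of norms has the default value \<open>0\<close>, but the compositions vanish there, so the
  inequality loses nothing.
\<close>

lemma onorm_on_compose_range_unbounded_iff:
  fixes X :: "nat \<Rightarrow> 'a::real_normed_vector set" and P :: "nat \<Rightarrow> 'a \<Rightarrow> 'a"
  assumes P: "\<And>n. projection_onto (X (Suc n)) (X n) (P n)"
  shows "(SUP (k, l)\<in>{(k, l). k < l}. onorm_on (X (Suc l)) (compose_range P k l)) = \<infinity> \<longleftrightarrow>
    \<not> (\<exists>M\<ge>0. \<forall>k l x. k < l \<longrightarrow> x \<in> X (Suc l) \<longrightarrow> norm (compose_range P k l x) \<le> M * norm x)"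
    (is "?S = \<infinity> \<longleftrightarrow> \<not> ?B")
proof -
  have X: "subspace (X n)" for n using P by (auto simp: projection_onto_def)
  have zero: "compose_range P k l 0 = 0" for k l
  proof -
    have "P n 0 = 0" for n using P[of n] subspace_0[OF X[of n]] by (auto simp: projection_onto_def)
    then have "foldr P ns 0 = 0" for ns by (induction ns) auto
    then show ?thesis by (simp add: compose_range_def)
  qed
  have bound_iff: "?S \<le> ereal M \<longleftrightarrow>
      (\<forall>k l x. k < l \<longrightarrow> x \<in> X (Suc l) \<longrightarrow> norm (compose_range P k l x) \<le> M * norm x)" if "0 \<le> M" for M
  proof -
    have "norm (compose_range P k l x) / norm x \<le> M \<longleftrightarrow> norm (compose_range P k l x) \<le> M * norm x" for k l x
      using that by (cases "x = 0") (auto simp: zero divide_le_eq)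
    then show ?thesis by (auto simp: SUP_le_iff onorm_on_def)
  qed
  have "?S \<noteq> \<infinity> \<longleftrightarrow> (\<exists>M\<ge>0. ?S \<le> ereal M)"
  proof
    assume "?S \<noteq> \<infinity>"
    then obtain n :: nat where "?S < ereal (real n)" unfolding less_PInf_Ex_of_nat ..
    then have "?S \<le> ereal (real n)" by (rule less_imp_le)
    then show "\<exists>M\<ge>0. ?S \<le> ereal M" by (intro exI[of _ "real n"]) simp
  next
    assume "\<exists>M\<ge>0. ?S \<le> ereal M"
    then obtain M where "?S \<le> ereal M" by blast
    then show "?S \<noteq> \<infinity>" by auto
  qed
  also have "\<dots> \<longleftrightarrow> ?B" by (intro ex_cong1 conj_cong refl bound_iff)
  finally have "?B \<longleftrightarrow> ?S \<noteq> \<infinity>" by (rule sym)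
  then show ?thesis by (simp only: not_not)
qed

lemma uniformly_bounded_projections:
  fixes X :: "nat \<Rightarrow> 'a::real_normed_vector set"
  assumes "(SUP i. relative_projection_constant (X i)) < \<infinity>" and X: "\<And>i. finite_dim_subspace (X i)"
  obtains T :: "nat \<Rightarrow> 'a \<Rightarrow>\<^sub>L 'a" and M
  where "\<And>i. finite_rank_projection (T i)" "\<And>i. range (T i) = X i" "\<And>i. norm (T i) \<le> M"
proof -
  have "(SUP i. relative_projection_constant (X i)) \<noteq> \<infinity>" using assms(1) by (rule less_imp_neq)
  then obtain n :: nat where n: "(SUP i. relative_projection_constant (X i)) < ereal (real n)"
    unfolding less_PInf_Ex_of_nat ..
  have "\<exists>T :: 'a \<Rightarrow>\<^sub>L 'a. finite_rank_projection T \<and> range (blinfun_apply T) = X i \<and> norm T \<le> real n" for i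
  proof -
    have "relative_projection_constant (X i) < ereal (real n)"
      using n SUP_upper[of i UNIV "\<lambda>i. relative_projection_constant (X i)"] by (meson UNIV_I le_less_trans)
    then obtain f where f: "projection f" "range f = X i" "onorm f < real n"
      unfolding relative_projection_constant_def INF_less_iff by auto
    have "finite_dim_subspace (range f)" using X f(2) by simp
    note * = finite_rank_projection_Blinfun[OF f(1) this]
    show ?thesis using * f by (intro exI[of _ "Blinfun f"]) (simp add: norm_blinfun.rep_eq)
  qed
  then show ?thesis using that by metis
qed

lemma strong_convergence_of_increasing_projections:
  fixes T :: "nat \<Rightarrow> 'a::real_normed_vector \<Rightarrow>\<^sub>L 'a"
  assumes T: "\<And>i. finite_rank_projection (T i)" "\<And>i. range (T i) = X i" "\<And>i. norm (T i) \<le> M"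
    and X: "\<And>i. X i \<subseteq> X (Suc i)" "closure (\<Union>i. X i) = UNIV"
  shows "(\<lambda>i. T i x) \<longlonglongrightarrow> x"
proof (rule strong_convergence_of_dense[OF T(3) X(2)])
  fix u assume "u \<in> (\<Union>i. X i)"
  then obtain i where i: "u \<in> X i" by blast
  have "T n u = u" if "n \<ge> i" for n
  proof -
    have "u \<in> X n" using lift_Suc_mono_le[of X, OF X(1) that] i by blast
    then show ?thesis using T(2) by (intro finite_rank_projection_fixes T(1)) simp
  qed
  then show "(\<lambda>n. T n u) \<longlonglongrightarrow> u"
    by (intro tendsto_eventually) (auto simp: eventually_sequentially)
qed

text \<open>
  A decomposition may be moved into the union of the \<open>X i\<close> and then interlaced with them. The resulting
  projections satisfy \<open>P n (P (n + 1)) = P n\<close>, so that all compositions collapse to their first factor.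
\<close>

lemma FDD_imp_bounded_compositions:
  fixes X :: "nat \<Rightarrow> 'a::banach set" and T :: "nat \<Rightarrow> 'a \<Rightarrow>\<^sub>L 'a"
  assumes "has_FDD TYPE('a)"
    and T: "\<And>i. finite_rank_projection (T i)" "\<And>i. range (T i) = X i" "\<And>i. norm (T i) \<le> M"
    and X: "\<And>i. X i \<subseteq> X (Suc i)" "closure (\<Union>i. X i) = UNIV"
  obtains s :: "nat \<Rightarrow> nat" and P :: "nat \<Rightarrow> 'a \<Rightarrow> 'a" and C
  where "strict_mono s" "\<And>n. projection_onto (X (s (Suc n))) (X (s n)) (P n)" "0 \<le> C"
    "\<And>k l x. k \<le> l \<Longrightarrow> norm (compose_range P k l x) \<le> C * norm x"
proof -
  have conv: "(\<lambda>i. T i x) \<longlonglongrightarrow> x" for x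
    by (rule strong_convergence_of_increasing_projections[OF T X])
  have X_sub: "subspace (X n)" for n
    using T(1)[of n] T(2)[of n] finite_dim_subspace_imp_subspace by (auto simp: finite_rank_projection_def)
  have X_mono: "X i \<subseteq> X j" if "i \<le> j" for i j using lift_Suc_mono_le[of X, OF X(1) that] .
  have U: "subspace (\<Union>i. X i)"
  proof (rule subspaceI)
    show "0 \<in> (\<Union>i. X i)" using subspace_0[OF X_sub] by blast
    show "c *\<^sub>R x \<in> (\<Union>i. X i)" if "x \<in> (\<Union>i. X i)" for c x
      using that subspace_scale[OF X_sub] by blast
    show "x + y \<in> (\<Union>i. X i)" if xy: "x \<in> (\<Union>i. X i)" "y \<in> (\<Union>i. X i)" for x y
    proof -
      obtain i j where "x \<in> X i" "y \<in> X j" using xy by blast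
      then have "x \<in> X (max i j)" "y \<in> X (max i j)" using X_mono[of i "max i j"] X_mono[of j "max i j"] by auto
      then show ?thesis using subspace_add[OF X_sub] by blast
    qed
  qed
  obtain S0 :: "nat \<Rightarrow> 'a \<Rightarrow>\<^sub>L 'a" where S0: "\<And>n. finite_rank_projection (S0 n)"
    "\<And>x. (\<lambda>n. S0 n x) \<longlonglongrightarrow> x" "\<And>n m x. S0 n (S0 m x) = S0 (min m n) x"
    using assms(1) unfolding has_FDD_iff_blinfun by blast
  have T_U: "range (T n) \<subseteq> (\<Union>i. X i)" for n using T(2) by blast
  obtain S :: "nat \<Rightarrow> 'a \<Rightarrow>\<^sub>L 'a" where S: "\<And>n. finite_rank_projection (S n)"
    "\<And>x. (\<lambda>n. S n x) \<longlonglongrightarrow> x" "\<And>n m x. S n (S m x) = S (min m n) x" "\<And>n. range (S n) \<subseteq> (\<Union>i. X i)"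
    using FDD_with_ranges_in_dense_union[OF S0 conv U T_U] by blast
  obtain s and P :: "nat \<Rightarrow> 'a \<Rightarrow>\<^sub>L 'a" and C where s: "strict_mono s"
    and P: "\<And>n. range (P n) \<subseteq> X (s n)" "\<And>n x. x \<in> X (s n) \<Longrightarrow> P n x = x"
      "\<And>n x. P n (P (Suc n) x) = P n x" "\<And>n. norm (P n) \<le> C"
    using commuting_projections_along_subsequence[OF S T X(1)] by blast
  have C: "0 \<le> C" using P(4)[of 0] norm_ge_zero order_trans by blast
  have P_bound: "norm (P n x) \<le> C * norm x" for n x
    using norm_blinfun[of "P n" x] mult_right_mono[OF P(4) norm_ge_zero[of x]] by (rule order_trans)
  have "projection_onto (X (s (Suc n))) (X (s n)) (P n)" for n
  proof -
    have sub: "X (s n) \<subseteq> X (s (Suc n))" using s by (intro X_mono) (simp add: strict_mono_less_eq)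
    have "P n ` X (s (Suc n)) = X (s n)"
    proof
      show "P n ` X (s (Suc n)) \<subseteq> X (s n)" using P(1) by blast
      show "X (s n) \<subseteq> P n ` X (s (Suc n))"
      proof
        fix x assume "x \<in> X (s n)"
        then show "x \<in> P n ` X (s (Suc n))" using P(2)[of x n] sub by (intro image_eqI[of _ _ x]) auto
      qed
    qed
    then show ?thesis
      unfolding projection_onto_def using sub X_sub P(2) P_bound
      by (auto simp: blinfun.add_right blinfun.scaleR_right intro!: exI[of _ C])
  qed
  moreover have "compose_range (\<lambda>n. blinfun_apply (P n)) k l x = P k x" if "k \<le> l" for k l x
    using that
  proof (induction k rule: inc_induct)
    case (step k)
    then show ?case by (simp add: compose_range_Suc_left P(3))
  qed (simp add: compose_range_same)
  ultimately show ?thesis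
    using s C P_bound by (intro that[of s "\<lambda>n. blinfun_apply (P n)" C]) auto
qed

lemma bounded_compositions_imp_FDD:
  fixes X :: "nat \<Rightarrow> 'a::banach set"
  assumes X: "\<And>n. finite_dim_subspace (X n)" "\<And>n. X n \<subseteq> X (Suc n)" "closure (\<Union>n. X n) = UNIV"
    and s: "strict_mono s" and P: "\<And>n. projection_onto (X (s (Suc n))) (X (s n)) (P n)"
    and M: "0 \<le> M"
      "\<And>k l x. k < l \<Longrightarrow> x \<in> X (s (Suc l)) \<Longrightarrow> norm (compose_range P k l x) \<le> M * norm x"
  shows "has_FDD TYPE('a)"
proof -
  have "X n \<subseteq> X (s n)" for n using lift_Suc_mono_le[of X, OF X(2)] seq_suble[OF s] by blast
  then have "(\<Union>n. X (s n)) = (\<Union>n. X n)" by blast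
  then interpret bounded_projection_chain "\<lambda>n. X (s n)" P M
    using X P M by unfold_locales auto
  show ?thesis by (rule FDD)
qed

theorem theorem1:
  assumes "separable_space (euclidean :: 'a::banach topology)"
  shows "pi_property TYPE('a) \<and> \<not> has_FDD TYPE('a) \<longleftrightarrow>
    (\<exists>X :: nat \<Rightarrow> 'a set.
       (\<forall>i. finite_dim_subspace (X i)) \<and>
       (\<forall>i. X i \<subseteq> X (Suc i)) \<and>
       (SUP i. relative_projection_constant (X i)) < \<infinity> \<and>
       closure (\<Union>i. X i) = UNIV \<and>
       (\<forall>(s :: nat \<Rightarrow> nat) (P :: nat \<Rightarrow> 'a \<Rightarrow> 'a).
          strict_mono s \<longrightarrow>
          (\<forall>n. projection_onto (X (s (Suc n))) (X (s n)) (P n)) \<longrightarrow>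
          (SUP (k, l)\<in>{(k, l). k < l}. onorm_on (X (s (Suc l))) (compose_range P k l)) = \<infinity>))"
proof (intro iffI conjI; (elim conjE exE)?)
  assume pi: "pi_property TYPE('a)" and no_FDD: "\<not> has_FDD TYPE('a)"
  obtain T :: "nat \<Rightarrow> 'a \<Rightarrow>\<^sub>L 'a" where T: "\<And>n. finite_rank_projection (T n)" "\<And>x. (\<lambda>n. T n x) \<longlonglongrightarrow> x"
    using pi unfolding pi_property_iff_blinfun by blast
  obtain R :: "nat \<Rightarrow> 'a \<Rightarrow>\<^sub>L 'a" and M
    where R: "\<And>n. finite_rank_projection (R n)" "\<And>n. range (R n) \<subseteq> range (R (Suc n))"
      "\<And>n. norm (R n) \<le> M" "\<And>x. (\<lambda>n. R n x) \<longlonglongrightarrow> x"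
    using increasing_projections[OF T] by blast
  define X where "X n = range (R n)" for n
  have X: "\<And>n. finite_dim_subspace (X n)" "\<And>n. X n \<subseteq> X (Suc n)"
    using R(1,2) by (auto simp: X_def finite_rank_projection_def)
  have dense: "closure (\<Union>n. X n) = UNIV"
  proof -
    have "x \<in> closure (\<Union>n. X n)" for x
      unfolding closure_sequential using R(4)[of x] by (intro exI[of _ "\<lambda>n. R n x"]) (auto simp: X_def)
    then show ?thesis by blast
  qed
  have "relative_projection_constant (X n) \<le> ereal M" for n
  proof -
    have "projection (R n)" using R(1)[of n] by (auto simp: finite_rank_projection_def intro: projection_blinfun)
    then show ?thesis
      unfolding relative_projection_constant_def X_def
      by (intro INF_lower2[of "blinfun_apply (R n)"]) (auto simp: R(3) simp flip: norm_blinfun.rep_eq)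
  qed
  then have "(SUP i. relative_projection_constant (X i)) \<le> ereal M" by (rule SUP_least)
  then have "(SUP i. relative_projection_constant (X i)) < \<infinity>" by (rule le_less_trans) simp
  moreover have "(SUP (k, l)\<in>{(k, l). k < l}. onorm_on (X (s (Suc l))) (compose_range P k l)) = \<infinity>"
    if s: "strict_mono s" and P: "\<forall>n. projection_onto (X (s (Suc n))) (X (s n)) (P n)"
    for s :: "nat \<Rightarrow> nat" and P :: "nat \<Rightarrow> 'a \<Rightarrow> 'a"
    unfolding onorm_on_compose_range_unbounded_iff[of "\<lambda>n. X (s n)" P, OF P[rule_format]]
  proof (intro notI, elim exE conjE)
    fix K :: real
    assume K: "0 \<le> K" "\<forall>k l x. k < l \<longrightarrow> x \<in> X (s (Suc l)) \<longrightarrow> norm (compose_range P k l x) \<le> K * norm x"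
    have "has_FDD TYPE('a)"
      by (rule bounded_compositions_imp_FDD[OF X dense s P[rule_format] K(1) K(2)[rule_format]])
    then show False using no_FDD by simp
  qed
  ultimately show "\<exists>X :: nat \<Rightarrow> 'a set.
       (\<forall>i. finite_dim_subspace (X i)) \<and>
       (\<forall>i. X i \<subseteq> X (Suc i)) \<and>
       (SUP i. relative_projection_constant (X i)) < \<infinity> \<and>
       closure (\<Union>i. X i) = UNIV \<and>
       (\<forall>(s :: nat \<Rightarrow> nat) (P :: nat \<Rightarrow> 'a \<Rightarrow> 'a).
          strict_mono s \<longrightarrow>
          (\<forall>n. projection_onto (X (s (Suc n))) (X (s n)) (P n)) \<longrightarrow>
          (SUP (k, l)\<in>{(k, l). k < l}. onorm_on (X (s (Suc l))) (compose_range P k l)) = \<infinity>)"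
    using X dense by (intro exI[of _ X] conjI allI impI) simp_all
next
  fix X :: "nat \<Rightarrow> 'a set"
  assume X: "\<forall>i. finite_dim_subspace (X i)" "\<forall>i. X i \<subseteq> X (Suc i)" "closure (\<Union>i. X i) = UNIV"
    and lambda: "(SUP i. relative_projection_constant (X i)) < \<infinity>"
    and unbounded: "\<forall>(s :: nat \<Rightarrow> nat) (P :: nat \<Rightarrow> 'a \<Rightarrow> 'a). strict_mono s \<longrightarrow>
          (\<forall>n. projection_onto (X (s (Suc n))) (X (s n)) (P n)) \<longrightarrow>
          (SUP (k, l)\<in>{(k, l). k < l}. onorm_on (X (s (Suc l))) (compose_range P k l)) = \<infinity>"
  obtain T :: "nat \<Rightarrow> 'a \<Rightarrow>\<^sub>L 'a" and M where T: "\<And>i. finite_rank_projection (T i)"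
    "\<And>i. range (T i) = X i" "\<And>i. norm (T i) \<le> M"
    using uniformly_bounded_projections[OF lambda X(1)[rule_format]] by blast
  show "pi_property TYPE('a)"
    unfolding pi_property_iff_blinfun
    by (intro exI[of _ T] conjI allI T(1)
        strong_convergence_of_increasing_projections[OF T X(2)[rule_format] X(3)])
  show "\<not> has_FDD TYPE('a)"
  proof
    assume FDD: "has_FDD TYPE('a)"
    obtain s and P :: "nat \<Rightarrow> 'a \<Rightarrow> 'a" and C where s: "strict_mono s"
      and P: "\<And>n. projection_onto (X (s (Suc n))) (X (s n)) (P n)"
      and C: "0 \<le> C" "\<And>k l x. k \<le> l \<Longrightarrow> norm (compose_range P k l x) \<le> C * norm x"
      using FDD_imp_bounded_compositions[OF FDD T X(2)[rule_format] X(3)] by blast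
    have "(SUP (k, l)\<in>{(k, l). k < l}. onorm_on (X (s (Suc l))) (compose_range P k l)) = \<infinity>"
      using P by (intro unbounded[rule_format] s)
    moreover have "\<exists>M\<ge>0. \<forall>k l x. k < l \<longrightarrow> x \<in> X (s (Suc l)) \<longrightarrow> norm (compose_range P k l x) \<le> M * norm x"
      using C by (intro exI[of _ C]) simp
    ultimately show False
      unfolding onorm_on_compose_range_unbounded_iff[of "\<lambda>n. X (s n)" P, OF P] by (rule notE)
  qed
qed

end
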